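(* Let $\Omega$ be a bounded convex domain in $\mathbb R^n$ with diameter $D$, and let $q$ be a convex function on $\Omega$. Let $\lambda_0<\lambda_1$ be the first and second Dirichlet eigenvalues of the operator $\Delta-q$ on $\Omega$. Then $$\lambda_0\ \ge\ n\left(\frac{\pi}{D}\right)^2+\inf_{x\in\Omega}q(x)$$ and $$\lambda_1\ \ge\ (n+3)\left(\frac{\pi}{D}\right)^2+\inf_{x\in\Omega}q(x).$$
   Context: Sign convention: $\lambda$ is a Dirichlet eigenvalue of $\Delta-q$ on $\Omega$ if there is a nonzero function $\phi$ with $\Delta\phi-q\phi=-\lambda\phi$ in $\Omega$ and $\phi=0$ on $\partial\Omega$. The eigenvalues are listed in increasing order $\lambda_0<\lambda_1\le\lambda_2\le\cdots$. *)

theory Defs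
  imports "HOL-Analysis.Analysis"
begin

definition partial_deriv :: "'n::finite \<Rightarrow> (real^'n \<Rightarrow> real) \<Rightarrow> real^'n \<Rightarrow> real" where
  "partial_deriv i f x = frechet_derivative f (at x) (axis i 1)"

text \<open>Meant for open \<open>S\<close>, where it is the usual class \<open>C\<^sup>2(S)\<close>; the differentiability conditions
  ensure that the values of \<^const>\<open>frechet_derivative\<close> involved are meaningful.\<close>

definition C2_on :: "(real^'n::finite) set \<Rightarrow> (real^'n \<Rightarrow> real) \<Rightarrow> bool" where
  "C2_on S f \<longleftrightarrow>
     (\<forall>x\<in>S. f differentiable (at x)) \<and>
     (\<forall>i. \<forall>x\<in>S. partial_deriv i f differentiable (at x)) \<and>
     (\<forall>i j. continuous_on S (partial_deriv j (partial_deriv i f)))"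

definition laplacian :: "(real^'n::finite \<Rightarrow> real) \<Rightarrow> real^'n \<Rightarrow> real" where
  "laplacian f x = (\<Sum>i\<in>UNIV. partial_deriv i (partial_deriv i f) x)"

text \<open>Classical eigenfunctions, in \<open>C\<^sup>2(\<Omega>)\<close> and continuous up to the boundary. The values of \<open>\<phi>\<close>
  outside the closure of \<open>\<Omega>\<close> are irrelevant, so nonzero means nonzero somewhere in \<open>\<Omega>\<close>.\<close>

definition dirichlet_eigenfunction ::
  "(real^'n::finite) set \<Rightarrow> (real^'n \<Rightarrow> real) \<Rightarrow> real \<Rightarrow> (real^'n \<Rightarrow> real) \<Rightarrow> bool" where
  "dirichlet_eigenfunction \<Omega> q lam \<phi> \<longleftrightarrow>
     C2_on \<Omega> \<phi> \<and> continuous_on (closure \<Omega>) \<phi> \<and>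
     (\<forall>x\<in>\<Omega>. laplacian \<phi> x - q x * \<phi> x = - lam * \<phi> x) \<and>
     (\<forall>x\<in>frontier \<Omega>. \<phi> x = 0) \<and>
     (\<exists>x\<in>\<Omega>. \<phi> x \<noteq> 0)"

definition dirichlet_eigenvalue ::
  "(real^'n::finite) set \<Rightarrow> (real^'n \<Rightarrow> real) \<Rightarrow> real \<Rightarrow> bool" where
  "dirichlet_eigenvalue \<Omega> q lam \<longleftrightarrow> (\<exists>\<phi>. dirichlet_eigenfunction \<Omega> q lam \<phi>)"

text \<open>The two initial terms of the increasing list \<open>\<lambda>\<^sub>0 < \<lambda>\<^sub>1 \<le> \<lambda>\<^sub>2 \<le> \<dots>\<close> of eigenvalues. As the
  inequality between the first two is strict, \<open>\<lambda>\<^sub>1\<close> is the least eigenvalue other than \<open>\<lambda>\<^sub>0\<close>,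
  whether or not the list repeats eigenvalues according to multiplicity.\<close>

definition first_two_dirichlet_eigenvalues ::
  "(real^'n::finite) set \<Rightarrow> (real^'n \<Rightarrow> real) \<Rightarrow> real \<Rightarrow> real \<Rightarrow> bool" where
  "first_two_dirichlet_eigenvalues \<Omega> q lam0 lam1 \<longleftrightarrow>
     dirichlet_eigenvalue \<Omega> q lam0 \<and> dirichlet_eigenvalue \<Omega> q lam1 \<and> lam0 < lam1 \<and>
     (\<forall>\<mu>. dirichlet_eigenvalue \<Omega> q \<mu> \<longrightarrow> \<mu> = lam0 \<or> lam1 \<le> \<mu>)"

end

theory Submission
  imports Defs
begin

text \<open>The bounds are the first and the second Dirichlet eigenvalue of a cube of side \<open>D\<close>, shifted by
  \<open>m = inf q\<close>, and the proof is the comparison of \<open>\<Omega>\<close> with such a cube. A set of diameter \<open>D\<close> lies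
  in a cube of side \<open>D\<close> (\<open>subset_cube_of_diameter\<close>), whose lowest Dirichlet eigenvalues are
  \<open>n (\<pi> / D)\<^sup>2\<close> and \<open>(n - 1 + 4) (\<pi> / D)\<^sup>2 = (n + 3) (\<pi> / D)\<^sup>2\<close>; eigenvalues decrease when the
  domain grows, and \<open>q \<ge> m\<close>. For the second eigenvalue monotonicity is the min-max argument: let
  \<open>u\<close>, \<open>v\<close> be eigenfunctions for the two eigenvalues. Some nonzero \<open>w = \<alpha> u + \<beta> v\<close> is orthogonal to
  the first eigenfunction of the cube, so its energy is at least \<open>(n + 3) (\<pi> / D)\<^sup>2 \<integral> w\<^sup>2\<close>, whereas
  by orthogonality of \<open>u\<close> and \<open>v\<close> it is at most \<open>(\<lambda>\<^sub>1 - m) \<integral> w\<^sup>2\<close>. No bound for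
  the gap between the two eigenvalues is needed.

  On the side of the cube, the lower bounds for the energy (\<open>dirichlet_energy_lower_bounds\<close>) follow
  from Fourier expansion: completeness of the products of sines, by Stone--Weierstrass
  (\<open>sine_span_dense\<close>), for the function, and Bessel's inequality for its partial derivatives.

  On the side of the eigenfunctions, the difficulty is that they are only classical: \<open>C\<^sup>2\<close> inside,
  continuous up to the boundary, with \<open>q\<close> possibly unbounded there. Everything is therefore computed
  for truncations \<open>c(\<rho>) w\<close>, where \<open>\<rho> = u\<^sup>2 + v\<^sup>2\<close> and \<open>c\<close> vanishes near zero, which are compactly
  supported in \<open>\<Omega>\<close>. Divergences of compactly supported fields have integral zero
  (\<open>integral_partial_eq_0\<close>). This gives, in turn, finite energy
  (\<open>integral_cutoff_energy_le\<close>), vanishing of the truncation errors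
  (\<open>cutoff_error_tendsto_0\<close>), orthogonality (\<open>eigenfunctions_orthogonal\<close>) and the energy of the
  combinations (\<open>truncation_energy_le\<close>). Convexity of \<open>q\<close> enters only to make the infimum a genuine
  lower bound (\<open>convex_on_imp_bdd_below\<close>).\<close>

section \<open>Partial derivatives and integrals of compactly supported functions\<close>

text \<open>\<open>g\<close> is the partial derivative of \<open>f\<close> in the \<open>i\<close>-th coordinate at all points of \<open>S\<close>. Only
  the restriction of \<open>f\<close> to lines parallel to the axis is differentiated, so that products and
  compositions reduce to the one-variable rules.\<close>

definition has_partial_on ::
  "(real^'n::finite) set \<Rightarrow> 'n \<Rightarrow> (real^'n \<Rightarrow> real) \<Rightarrow> (real^'n \<Rightarrow> real) \<Rightarrow> bool" where
  "has_partial_on S i f g \<longleftrightarrow>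
     (\<forall>x\<in>S. ((\<lambda>t. f (x + t *\<^sub>R axis i 1)) has_real_derivative g x) (at 0))"

lemma has_partial_onD:
  "has_partial_on S i f g \<Longrightarrow> x \<in> S \<Longrightarrow>
     ((\<lambda>t. f (x + t *\<^sub>R axis i 1)) has_real_derivative g x) (at 0)"
  by (auto simp: has_partial_on_def)

lemma has_partial_on_const: "has_partial_on S i (\<lambda>x. c) (\<lambda>x. 0)"
  by (simp add: has_partial_on_def)

lemma has_partial_on_add:
  "has_partial_on S i f f' \<Longrightarrow> has_partial_on S i g g' \<Longrightarrow>
     has_partial_on S i (\<lambda>x. f x + g x) (\<lambda>x. f' x + g' x)"
  by (auto simp: has_partial_on_def intro!: DERIV_add)

lemma has_partial_on_mult:
  assumes "has_partial_on S i f f'" and "has_partial_on S i g g'"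
  shows "has_partial_on S i (\<lambda>x. f x * g x) (\<lambda>x. f' x * g x + f x * g' x)"
  unfolding has_partial_on_def
proof
  fix x assume "x \<in> S"
  with DERIV_mult[OF has_partial_onD[OF assms(1)] has_partial_onD[OF assms(2)], of x]
  show "((\<lambda>t. f (x + t *\<^sub>R axis i 1) * g (x + t *\<^sub>R axis i 1)) has_real_derivative
      f' x * g x + f x * g' x) (at 0)"
    by (simp add: algebra_simps)
qed

lemma has_partial_on_compose:
  assumes "has_partial_on S i f f'" and "\<And>x. x \<in> S \<Longrightarrow> (c has_real_derivative c' (f x)) (at (f x))"
  shows "has_partial_on S i (\<lambda>x. c (f x)) (\<lambda>x. c' (f x) * f' x)"
  unfolding has_partial_on_def
proof
  fix x assume "x \<in> S"
  with DERIV_chain'[OF has_partial_onD[OF assms(1)], of x c "c' (f x)"] assms(2)[of x]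
  show "((\<lambda>t. c (f (x + t *\<^sub>R axis i 1))) has_real_derivative c' (f x) * f' x) (at 0)"
    by (simp add: mult.commute)
qed

lemma set_integrable_continuous_compact_support:
  fixes h :: "real^'n::finite \<Rightarrow> real"
  assumes "continuous_on S h" and "compact K" and "K \<subseteq> S" and "\<And>x. x \<in> S - K \<Longrightarrow> h x = 0"
  shows "set_integrable lborel S h"
proof -
  have "(\<lambda>x. indicator S x *\<^sub>R h x) = (\<lambda>x. indicator K x *\<^sub>R h x)"
    using assms(3,4) by (auto simp: indicator_def fun_eq_iff)
  moreover have "integrable lborel (\<lambda>x. indicator K x *\<^sub>R h x)"
    using assms by (intro borel_integrable_compact) (auto intro: continuous_on_subset)
  ultimately show ?thesis
    by (simp add: set_integrable_def)
qed

lemma continuous_on_extend_by_zero: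
  fixes h :: "'a::t2_space \<Rightarrow> real"
  assumes "open S" and "compact K" and "K \<subseteq> S" and "continuous_on S h"
    and "\<And>x. x \<in> S - K \<Longrightarrow> h x = 0"
  shows "continuous_on UNIV (\<lambda>x. if x \<in> S then h x else 0)"
proof -
  have "continuous_on S (\<lambda>x. if x \<in> S then h x else 0)"
    using assms(4) by (simp cong: continuous_on_cong)
  moreover have "continuous_on (- K) (\<lambda>x. if x \<in> S then h x else 0)"
    using assms(5) by (intro continuous_on_eq[OF continuous_on_const[of _ 0]]) auto
  moreover have "open (- K)" using assms(2) by (simp add: compact_imp_closed open_Compl)
  moreover have "S \<union> - K = UNIV" using assms(3) by auto
  ultimately show ?thesis
    using assms(1) continuous_on_open_Un by metis
qed

lemma has_partial_on_extend_by_zero: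
  assumes "open S" and "compact K" and "K \<subseteq> S" and "has_partial_on S i h g"
    and "\<And>x. x \<in> S - K \<Longrightarrow> h x = 0"
  shows "has_partial_on UNIV i (\<lambda>x. if x \<in> S then h x else 0)
           (\<lambda>x. if x \<in> S then g x else 0)"
    and "\<And>x. x \<in> S - K \<Longrightarrow> g x = 0"
proof -
  have near: "\<forall>\<^sub>F t in nhds 0. x + t *\<^sub>R axis i 1 \<in> T" if "open T" "x \<in> T" for x and T :: "(real^'a) set"
  proof -
    have "((\<lambda>t. x + t *\<^sub>R axis i (1::real)) \<longlongrightarrow> x + 0 *\<^sub>R axis i 1) (nhds 0)"
      by (intro tendsto_intros filterlim_ident)
    with that show ?thesis by (auto dest: topological_tendstoD)
  qed
  have K': "open (- K)" using assms(2) by (simp add: compact_imp_closed open_Compl)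
  have zero: "((\<lambda>t. if x + t *\<^sub>R axis i 1 \<in> S then h (x + t *\<^sub>R axis i 1) else 0)
      has_real_derivative 0) (at 0)" if "x \<notin> K" for x
  proof -
    have "\<forall>\<^sub>F t in nhds 0. (if x + t *\<^sub>R axis i 1 \<in> S then h (x + t *\<^sub>R axis i 1) else 0) = 0"
      using near[OF K', of x] that assms(5) by (auto elim!: eventually_mono)
    then show ?thesis
      using DERIV_cong_ev[of 0 0 _ "\<lambda>_. 0" 0 0] by auto
  qed
  have same: "((\<lambda>t. if x + t *\<^sub>R axis i 1 \<in> S then h (x + t *\<^sub>R axis i 1) else 0)
      has_real_derivative g x) (at 0)" if "x \<in> S" for x
  proof -
    have "\<forall>\<^sub>F t in nhds 0. (if x + t *\<^sub>R axis i 1 \<in> S then h (x + t *\<^sub>R axis i 1) else 0)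
        = h (x + t *\<^sub>R axis i 1)"
      using near[OF assms(1) that] by (auto elim!: eventually_mono)
    then show ?thesis
      using has_partial_onD[OF assms(4) that] DERIV_cong_ev[of 0 0 _ _ "g x" "g x"] by auto
  qed
  show "has_partial_on UNIV i (\<lambda>x. if x \<in> S then h x else 0) (\<lambda>x. if x \<in> S then g x else 0)"
    unfolding has_partial_on_def using zero same assms(3) by auto
  show "g x = 0" if "x \<in> S - K" for x
    using DERIV_unique[OF zero[of x] same[of x]] that by simp
qed

lemma lborel_integral_translate:
  fixes f :: "'a::euclidean_space \<Rightarrow> real"
  assumes "f \<in> borel_measurable borel"
  shows "(\<integral>x. f (x + c) \<partial>lborel) = (\<integral>x. f x \<partial>lborel)"
proof -
  have "(\<integral>x. f x \<partial>lborel) = (\<integral>x. f x \<partial>distr lborel borel ((+) c))"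
    by (simp add: lborel_distr_plus)
  also have "\<dots> = (\<integral>x. f (c + x) \<partial>lborel)"
    using assms by (intro integral_distr) auto
  finally show ?thesis by (simp add: add.commute)
qed

lemma integrable_translate:
  fixes f :: "'a::euclidean_space \<Rightarrow> real"
  assumes "integrable lborel f"
  shows "integrable lborel (\<lambda>x. f (x + c))"
proof -
  have "integrable (distr lborel borel ((+) c)) f"
    using assms by (simp add: lborel_distr_plus)
  then have "integrable lborel (\<lambda>x. f (c + x))"
    by (subst (asm) integrable_distr_eq) (use assms in auto)
  then show ?thesis by (simp add: add.commute)
qed

text \<open>The divergence theorem without boundary, one coordinate at a time: the difference quotients of
  the extension by zero have integral zero by translation invariance, and they converge boundedly,
  on a fixed bounded set, to the derivative. No iterated integration is needed.\<close>

lemma integral_partial_eq_0: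
  fixes S :: "(real^'n::finite) set"
  assumes "open S" and "compact K" and "K \<subseteq> S"
    and "continuous_on S h" and "continuous_on S g"
    and "has_partial_on S i h g" and "\<And>x. x \<in> S - K \<Longrightarrow> h x = 0"
  shows "set_integrable lborel S g" and "(LINT x:S|lborel. g x) = 0"
proof -
  define H where "H x = (if x \<in> S then h x else 0)" for x
  define G where "G x = (if x \<in> S then g x else 0)" for x
  have g0: "g x = 0" if "x \<in> S - K" for x
    using has_partial_on_extend_by_zero(2)[OF assms(1-3,6,7)] that by auto
  show "set_integrable lborel S g"
    using assms(5,2,3) g0 by (rule set_integrable_continuous_compact_support)
  have HG: "has_partial_on UNIV i H G"
    unfolding H_def[abs_def] G_def[abs_def]
    by (rule has_partial_on_extend_by_zero(1)[OF assms(1-3,6,7)])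
  have cH: "continuous_on UNIV H" and cG: "continuous_on UNIV G"
    unfolding H_def[abs_def] G_def[abs_def] using assms(1-5,7) g0
    by (auto intro!: continuous_on_extend_by_zero)
  have [measurable]: "H \<in> borel_measurable borel" "G \<in> borel_measurable borel"
    using cH cG by (auto intro: borel_measurable_continuous_onI)
  have H0: "H x = 0" "G x = 0" if "x \<notin> K" for x
    using that assms(7) g0 by (auto simp: H_def G_def)
  have "compact (G ` K)"
    using cG assms(2) by (auto intro: compact_continuous_image continuous_on_subset)
  then obtain B0 where B0: "\<And>x. x \<in> K \<Longrightarrow> \<bar>G x\<bar> \<le> B0"
    using compact_imp_bounded[of "G ` K"] by (auto simp: bounded_iff)
  define B where "B = max B0 0"
  have B: "\<bar>G x\<bar> \<le> B" for x
    using B0[of x] H0(2)[of x] by (cases "x \<in> K") (auto simp: B_def)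
  define e :: "real^'n" where "e = axis i 1"
  have norm_e: "norm e = 1" by (simp add: e_def)
  have line: "((\<lambda>t. H (x + t *\<^sub>R e)) has_real_derivative G (x + t *\<^sub>R e)) (at t)" for x t
  proof -
    have "((\<lambda>s. H ((x + t *\<^sub>R e) + s *\<^sub>R e)) has_real_derivative G (x + t *\<^sub>R e)) (at 0)"
      using has_partial_onD[OF HG] by (simp add: e_def)
    then have "((\<lambda>s. H (x + (s + t) *\<^sub>R e)) has_real_derivative G (x + t *\<^sub>R e)) (at 0)"
      by (simp add: algebra_simps)
    then show ?thesis
      using DERIV_shift[of "\<lambda>s. H (x + s *\<^sub>R e)" "G (x + t *\<^sub>R e)" 0 t] by (simp add: add.commute)
  qed
  define t :: "nat \<Rightarrow> real" where "t k = inverse (real (Suc k))" for k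
  have t: "0 < t k" "t k \<le> 1" for k by (auto simp: t_def inverse_le_1_iff)
  have t0: "t \<longlonglongrightarrow> 0" unfolding t_def[abs_def] by (rule LIMSEQ_inverse_real_of_nat)
  define Q where "Q k x = (H (x + t k *\<^sub>R e) - H x) / t k" for k x
  obtain R where R: "\<And>x. x \<in> K \<Longrightarrow> norm x \<le> R"
    using compact_imp_bounded[OF assms(2)] unfolding bounded_iff by auto
  define K2 where "K2 = cball (0::real^'n) (R + 1)"
  have intH: "integrable lborel H"
  proof -
    have "set_integrable lborel UNIV H"
      using cH assms(2) H0(1) by (intro set_integrable_continuous_compact_support[where K=K]) auto
    then show ?thesis by (simp add: set_integrable_def)
  qed
  have intQ: "(\<integral>x. Q k x \<partial>lborel) = 0" for k
  proof -
    have "(\<integral>x. Q k x \<partial>lborel) = ((\<integral>x. H (x + t k *\<^sub>R e) \<partial>lborel) - (\<integral>x. H x \<partial>lborel)) / t k"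
      unfolding Q_def using integrable_translate[OF intH] intH by simp
    also have "\<dots> = 0" by (subst lborel_integral_translate) auto
    finally show ?thesis .
  qed
  have bound: "\<bar>Q k x\<bar> \<le> B * indicator K2 x" for k x
  proof (cases "x \<in> K2")
    case True
    \<comment> \<open>a value of the continuous, compactly supported derivative, hence at most \<open>B\<close>\<close>
    obtain z where "0 < z" "z < t k"
      "H (x + t k *\<^sub>R e) - H (x + 0 *\<^sub>R e) = (t k - 0) * G (x + z *\<^sub>R e)"
      using MVT2[OF t(1)[of k], of "\<lambda>s. H (x + s *\<^sub>R e)" "\<lambda>s. G (x + s *\<^sub>R e)"] line by blast
    then have "Q k x = G (x + z *\<^sub>R e)"
      using t(1)[of k] by (simp add: Q_def)
    then show ?thesis using B True by simp
  next
    case False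
    then have n: "norm x > R + 1" by (simp add: K2_def)
    then have "x \<notin> K" using R[of x] by auto
    moreover have "x + t k *\<^sub>R e \<notin> K"
    proof
      assume "x + t k *\<^sub>R e \<in> K"
      then have "norm (x + t k *\<^sub>R e) \<le> R" by (rule R)
      moreover have "norm x \<le> norm (x + t k *\<^sub>R e) + norm (t k *\<^sub>R e)"
        using norm_triangle_ineq4[of "x + t k *\<^sub>R e" "t k *\<^sub>R e"] by simp
      ultimately show False using n t[of k] norm_e by simp
    qed
    ultimately show ?thesis using H0(1) False by (simp add: Q_def)
  qed
  have lim: "(\<lambda>k. Q k x) \<longlonglongrightarrow> G x" for x
  proof -
    have "((\<lambda>s. (H (x + s *\<^sub>R e) - H (x + 0 *\<^sub>R e)) / (s - 0)) \<longlongrightarrow> G x) (at 0)"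
      using line[of x 0] by (simp add: has_field_derivative_iff)
    moreover have "filterlim t (at 0) sequentially"
      using t0 t(1) by (auto simp: filterlim_at less_imp_neq[symmetric] intro!: always_eventually)
    ultimately have "(\<lambda>k. (H (x + t k *\<^sub>R e) - H (x + 0 *\<^sub>R e)) / (t k - 0)) \<longlonglongrightarrow> G x"
      by (rule filterlim_compose)
    then show ?thesis by (simp add: Q_def)
  qed
  have "(\<lambda>k. \<integral>x. Q k x \<partial>lborel) \<longlonglongrightarrow> (\<integral>x. G x \<partial>lborel)"
  proof (rule integral_dominated_convergence)
    show "integrable lborel (\<lambda>x. B * indicator K2 x)"
      by (intro integrable_mult_right integrable_real_indicator)
        (use emeasure_bounded_finite[of K2] in \<open>simp_all add: K2_def\<close>)
  qed (use lim bound in \<open>auto simp: Q_def\<close>)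
  then have "(\<integral>x. G x \<partial>lborel) = 0" unfolding intQ by (simp add: LIMSEQ_const_iff)
  moreover have "G = (\<lambda>x. indicator S x *\<^sub>R g x)" by (auto simp: G_def fun_eq_iff)
  ultimately show "(LINT x:S|lborel. g x) = 0"
    by (simp add: set_lebesgue_integral_def)
qed

section \<open>Products of sines on a cube\<close>

lemma integral_prod_components:
  fixes h :: "'n::finite \<Rightarrow> real \<Rightarrow> real"
  assumes "\<And>j. integrable lborel (h j)"
  shows "(\<integral>x. (\<Prod>j\<in>UNIV. h j (x $ j)) \<partial>lborel) = (\<Prod>j\<in>UNIV. \<integral>t. h j t \<partial>lborel)"
proof -
  interpret product_sigma_finite "\<lambda>_::real^'n. lborel :: real measure" ..
  define ax :: "'n \<Rightarrow> real^'n" where "ax j = axis j 1" for j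
  have inj: "inj ax" by (auto simp: inj_on_def ax_def axis_eq_axis)
  have B: "Basis = range ax" by (auto simp: Basis_vec_def ax_def)
  have [measurable]: "h j \<in> borel_measurable borel" for j
    using borel_measurable_integrable[OF assms[of j]] by simp
  have comp: "(\<Sum>b\<in>Basis. f b *\<^sub>R b) $ j = f (ax j)" for f :: "real^'n \<Rightarrow> real" and j
  proof -
    have "(\<Sum>b\<in>Basis. f b *\<^sub>R b) = (\<Sum>l\<in>UNIV. f (ax l) *\<^sub>R ax l)"
      unfolding B by (simp add: sum.reindex[OF inj])
    then show ?thesis by (simp add: ax_def axis_def if_distrib sum.delta' cong: if_cong)
  qed
  have "(\<integral>x. (\<Prod>j\<in>UNIV. h j (x $ j)) \<partial>(lborel :: (real^'n) measure))
      = (\<integral>f. (\<Prod>j\<in>UNIV. h j ((\<Sum>b\<in>Basis. f b *\<^sub>R b) $ j)) \<partial>(\<Pi>\<^sub>M b\<in>(Basis::(real^'n) set). lborel))"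
    by (subst lborel_eq) (rule integral_distr, measurable)
  also have "\<dots> = (\<integral>f. (\<Prod>b\<in>Basis. h (inv ax b) (f b)) \<partial>(\<Pi>\<^sub>M b\<in>(Basis::(real^'n) set). lborel))"
    unfolding comp unfolding B by (simp add: prod.reindex[OF inj] inv_f_f[OF inj])
  also have "\<dots> = (\<Prod>b\<in>Basis. \<integral>t. h (inv ax b) t \<partial>lborel)"
    by (rule product_integral_prod) (use assms in auto)
  also have "\<dots> = (\<Prod>j\<in>UNIV. \<integral>t. h j t \<partial>lborel)"
    unfolding B by (simp add: prod.reindex[OF inj] inv_f_f[OF inj])
  finally show ?thesis .
qed

lemma set_integral_cbox_prod:
  fixes h :: "'n::finite \<Rightarrow> real \<Rightarrow> real" and a b :: "real^'n"
  assumes "\<And>j. continuous_on UNIV (h j)"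
  shows "(LINT x:cbox a b|lborel. (\<Prod>j\<in>UNIV. h j (x $ j)))
       = (\<Prod>j\<in>UNIV. LINT t:{a $ j..b $ j}|lborel. h j t)"
proof -
  have ind: "indicator (cbox a b) x = (\<Prod>j\<in>UNIV. indicat_real {a $ j..b $ j} (x $ j))" for x
  proof (cases "x \<in> cbox a b")
    case True then show ?thesis by (simp add: mem_box_cart)
  next
    case False
    then obtain j where "x $ j \<notin> {a $ j..b $ j}" by (auto simp: mem_box_cart)
    then have "(\<Prod>j\<in>UNIV. indicat_real {a $ j..b $ j} (x $ j)) = 0"
      by (intro prod_zero bexI[of _ j]) auto
    with False show ?thesis by simp
  qed
  have "integrable lborel (\<lambda>t. indicator {a $ j..b $ j} t *\<^sub>R h j t)" for j
    using borel_integrable_compact[of "{a $ j..b $ j}" "h j"] assms[of j]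
    by (auto intro: continuous_on_subset)
  from integral_prod_components[OF this] show ?thesis
    by (simp add: set_lebesgue_integral_def ind prod.distrib)
qed

text \<open>The Dirichlet eigenfunctions of the Laplacian on the cube with corner \<open>a\<close> and side \<open>L\<close>. All
  multi-indices are permitted; a zero entry gives the zero function, and the eigenfunctions proper
  are those with all entries at least 1.\<close>

definition sine_mode :: "real \<Rightarrow> real^'n::finite \<Rightarrow> ('n \<Rightarrow> nat) \<Rightarrow> real^'n \<Rightarrow> real" where
  "sine_mode L a k x = (\<Prod>j\<in>UNIV. sin (real (k j) * (pi / L) * (x $ j - a $ j)))"

text \<open>The partial derivative of \<^const>\<open>sine_mode\<close> in the \<open>i\<close>-th coordinate.\<close>

definition sine_mode_deriv ::
  "real \<Rightarrow> real^'n::finite \<Rightarrow> 'n \<Rightarrow> ('n \<Rightarrow> nat) \<Rightarrow> real^'n \<Rightarrow> real" where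
  "sine_mode_deriv L a i k x = real (k i) * (pi / L) *
     (\<Prod>j\<in>UNIV. (if j = i then cos else sin) (real (k j) * (pi / L) * (x $ j - a $ j)))"

lemma continuous_on_trig_linear:
  fixes f :: "real \<Rightarrow> real" and c :: real and g :: "'a::t2_space \<Rightarrow> real"
  assumes "f = sin \<or> f = cos" and "continuous_on S g"
  shows "continuous_on S (\<lambda>x. f (r * c * (g x - b)))"
proof -
  have "continuous_on S (\<lambda>x. r * c * (g x - b))"
    using assms(2) by (intro continuous_intros)
  with assms(1) show ?thesis
    by (auto intro: continuous_on_sin continuous_on_cos)
qed

lemma continuous_on_sine_mode [continuous_intros]: "continuous_on S (sine_mode L a k)"
  unfolding sine_mode_def[abs_def] by (intro continuous_intros)

lemma continuous_on_sine_mode_deriv [continuous_intros]: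
  "continuous_on S (sine_mode_deriv L a i k)"
proof -
  have "continuous_on S (\<lambda>x. (if j = i then cos else sin) (real (k j) * (pi / L) * (x $ j - a $ j)))"
    for j by (rule continuous_on_trig_linear) (auto intro!: continuous_intros)
  then show ?thesis
    unfolding sine_mode_deriv_def[abs_def] by (intro continuous_intros)
qed

lemma integral_cos_period:
  fixes L a :: real and m :: int
  assumes "L > 0"
  shows "(LINT t:{a..a + L}|lborel. cos (of_int m * (pi / L) * (t - a))) = (if m = 0 then L else 0)"
proof (cases "m = 0")
  case True
  then show ?thesis using assms by (simp add: set_lebesgue_integral_def)
next
  case False
  define c where "c = of_int m * (pi / L)"
  have c: "c \<noteq> 0" using False assms by (simp add: c_def)
  have "(\<integral>t. indicator {a..a + L} t *\<^sub>R cos (c * (t - a)) \<partial>lborel)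
      = sin (c * (a + L - a)) / c - sin (c * (a - a)) / c"
    using assms c
    by (intro integral_FTC_atLeastAtMost)
       (auto intro!: derivative_eq_intros continuous_intros simp: has_real_derivative_iff_has_vector_derivative[symmetric])
  also have "\<dots> = sin (of_int m * pi) / c" using assms by (simp add: c_def)
  also have "\<dots> = 0" by (simp add: sin_zero_iff_int2)
  finally show ?thesis using False by (simp add: set_lebesgue_integral_def c_def)
qed

text \<open>Only \<open>k\<close> has to be positive: for the cosine, \<open>k = l = 0\<close> would give \<open>L\<close> instead of \<open>L / 2\<close>.\<close>

lemma integral_trig_trig:
  fixes L a :: real and k l :: nat and f :: "real \<Rightarrow> real"
  assumes "L > 0" and "k \<ge> 1" and "f = sin \<or> f = cos"
  shows "(LINT t:{a..a + L}|lborel. f (real k * (pi / L) * (t - a)) * f (real l * (pi / L) * (t - a)))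
       = (if k = l then L / 2 else 0)"
proof -
  define C where "C m t = cos (of_int m * (pi / L) * (t - a))" for m :: int and t
  define s :: real where "s = (if f = sin then - 1 / 2 else 1 / 2)"
  have sc: "sin \<noteq> (cos :: real \<Rightarrow> real)"
  proof
    assume "sin = (cos :: real \<Rightarrow> real)"
    from fun_cong[OF this, of 0] show False by simp
  qed
  have eq: "f (real k * (pi / L) * (t - a)) * f (real l * (pi / L) * (t - a))
      = 1 / 2 * C (int k - int l) t + s * C (int k + int l) t" for t
    using assms(3) sc
    by (auto simp: sin_times_sin cos_times_cos C_def s_def algebra_simps diff_divide_distrib add_divide_distrib)
  have int: "set_integrable lborel {a..a + L} (C m)" for m
    unfolding C_def[abs_def] by (intro borel_integrable_atLeastAtMost' continuous_intros)
  have v: "(LINT t:{a..a + L}|lborel. C m t) = (if m = 0 then L else 0)" for m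
    unfolding C_def by (rule integral_cos_period[OF assms(1)])
  show ?thesis
    unfolding eq using int assms(2) by (simp add: v)
qed

lemma integral_sine_mode_sine_mode:
  fixes a :: "real^'n::finite"
  assumes "L > 0" and "\<And>j. k j \<ge> 1"
  shows "(LINT x:cbox a (\<chi> j. a $ j + L)|lborel. sine_mode L a k x * sine_mode L a l x)
       = (if k = l then (L / 2) ^ CARD('n) else 0)"
proof -
  have cont: "continuous_on UNIV (\<lambda>t. sin (real (k j) * (pi / L) * (t - a $ j)) * sin (real (l j) * (pi / L) * (t - a $ j)))" for j
    by (intro continuous_on_mult continuous_on_trig_linear continuous_on_id) auto
  have "(LINT x:cbox a (\<chi> j. a $ j + L)|lborel. sine_mode L a k x * sine_mode L a l x)
     = (\<Prod>j\<in>UNIV. if k j = l j then L / 2 else 0)"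
    unfolding sine_mode_def prod.distrib[symmetric]
    by (subst set_integral_cbox_prod[OF cont])
       (use integral_trig_trig[OF assms(1) assms(2), of sin] in simp)
  also have "\<dots> = (if k = l then (L / 2) ^ CARD('n) else 0)"
    by (auto simp: fun_eq_iff)
  finally show ?thesis .
qed

lemma integral_sine_mode_deriv_sine_mode_deriv:
  fixes a :: "real^'n::finite"
  assumes "L > 0" and "\<And>j. k j \<ge> 1"
  shows "(LINT x:cbox a (\<chi> j. a $ j + L)|lborel. sine_mode_deriv L a i k x * sine_mode_deriv L a i l x)
       = (if k = l then (real (k i) * (pi / L))\<^sup>2 * (L / 2) ^ CARD('n) else 0)"
proof -
  let ?f = "\<lambda>j. if j = i then cos else (sin :: real \<Rightarrow> real)"
  have f: "?f j = sin \<or> ?f j = cos" for j by auto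
  have cont: "continuous_on UNIV (\<lambda>t. ?f j (real (k j) * (pi / L) * (t - a $ j)) * ?f j (real (l j) * (pi / L) * (t - a $ j)))" for j
    by (intro continuous_on_mult continuous_on_trig_linear[OF f] continuous_on_id)
  have "(LINT x:cbox a (\<chi> j. a $ j + L)|lborel. sine_mode_deriv L a i k x * sine_mode_deriv L a i l x)
     = (real (k i) * (pi / L)) * (real (l i) * (pi / L)) *
       (LINT x:cbox a (\<chi> j. a $ j + L)|lborel. (\<Prod>j\<in>UNIV.
          ?f j (real (k j) * (pi / L) * (x $ j - a $ j)) * ?f j (real (l j) * (pi / L) * (x $ j - a $ j))))"
    unfolding sine_mode_deriv_def prod.distrib set_integral_mult_right[symmetric]
    by (rule set_lebesgue_integral_cong) (auto simp: algebra_simps)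
  also have "\<dots> = (real (k i) * (pi / L)) * (real (l i) * (pi / L)) * (\<Prod>j\<in>UNIV. if k j = l j then L / 2 else 0)"
    by (subst set_integral_cbox_prod[OF cont])
       (use integral_trig_trig[OF assms(1) assms(2) f] in simp)
  also have "(\<Prod>j\<in>UNIV. if k j = l j then L / 2 else 0) = (if k = l then (L / 2) ^ CARD('n) else 0)"
    by (auto simp: fun_eq_iff)
  finally show ?thesis by (auto simp: power2_eq_square)
qed

section \<open>Orthogonal expansions and completeness\<close>

lemma set_integral_sum_continuous:
  fixes f :: "'k \<Rightarrow> real^'n::finite \<Rightarrow> real"
  assumes "compact Q" and "\<And>k. k \<in> K \<Longrightarrow> continuous_on Q (f k)"
  shows "(LINT x:Q|lborel. (\<Sum>k\<in>K. f k x)) = (\<Sum>k\<in>K. LINT x:Q|lborel. f k x)"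
  unfolding set_lebesgue_integral_def scaleR_sum_right
  by (rule Bochner_Integration.integral_sum) (intro borel_integrable_compact assms)

lemma set_integrable_continuous_compact:
  fixes f :: "real^'n::finite \<Rightarrow> real"
  shows "compact Q \<Longrightarrow> continuous_on Q f \<Longrightarrow> set_integrable lborel Q f"
  unfolding set_integrable_def by (rule borel_integrable_compact)

lemma integral_square_diff_orthogonal:
  fixes c :: "'k \<Rightarrow> real^'n::finite \<Rightarrow> real"
  assumes "compact Q" and "finite K" and g: "continuous_on Q g"
    and c: "\<And>k. k \<in> K \<Longrightarrow> continuous_on Q (c k)"
    and orth: "\<And>k l. k \<in> K \<Longrightarrow> l \<in> K \<Longrightarrow>
      (LINT x:Q|lborel. c k x * c l x) = (if k = l then d k else 0)"
  shows "(LINT x:Q|lborel. (g x - (\<Sum>k\<in>K. s k * c k x))\<^sup>2)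
       = (LINT x:Q|lborel. (g x)\<^sup>2) + (\<Sum>k\<in>K. (s k)\<^sup>2 * d k - 2 * s k * (LINT x:Q|lborel. g x * c k x))"
proof -
  note int = set_integrable_continuous_compact[OF assms(1)]
  have 1: "(LINT x:Q|lborel. (\<Sum>k\<in>K. 2 * s k * (g x * c k x)))
      = (\<Sum>k\<in>K. 2 * s k * (LINT x:Q|lborel. g x * c k x))"
    by (subst set_integral_sum_continuous) (auto intro!: continuous_intros assms)
  have "(LINT x:Q|lborel. (\<Sum>k\<in>K. \<Sum>l\<in>K. s k * s l * (c k x * c l x)))
      = (\<Sum>k\<in>K. \<Sum>l\<in>K. s k * s l * (LINT x:Q|lborel. c k x * c l x))"
  proof -
    have "(LINT x:Q|lborel. (\<Sum>l\<in>K. s k * s l * (c k x * c l x)))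
        = (\<Sum>l\<in>K. s k * s l * (LINT x:Q|lborel. c k x * c l x))" if "k \<in> K" for k
      by (subst set_integral_sum_continuous[OF assms(1)])
         (use c that in \<open>auto intro!: continuous_on_mult continuous_on_const\<close>)
    then show ?thesis
      by (subst set_integral_sum_continuous[OF assms(1)])
         (use c in \<open>auto intro!: continuous_on_mult continuous_on_sum continuous_on_const\<close>)
  qed
  also have "\<dots> = (\<Sum>k\<in>K. (s k)\<^sup>2 * d k)"
    using assms(2) by (intro sum.cong refl)
      (simp add: orth if_distrib sum.delta power2_eq_square cong: if_cong)
  finally have 2: "(LINT x:Q|lborel. (\<Sum>k\<in>K. \<Sum>l\<in>K. s k * s l * (c k x * c l x))) = (\<Sum>k\<in>K. (s k)\<^sup>2 * d k)" .
  have "(LINT x:Q|lborel. (g x - (\<Sum>k\<in>K. s k * c k x))\<^sup>2)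
     = (LINT x:Q|lborel. ((g x)\<^sup>2 - (\<Sum>k\<in>K. 2 * s k * (g x * c k x))) +
          (\<Sum>k\<in>K. \<Sum>l\<in>K. s k * s l * (c k x * c l x)))"
    by (rule arg_cong[where f="set_lebesgue_integral _ _"])
       (simp add: fun_eq_iff power2_diff power2_eq_square sum_product sum_distrib_left algebra_simps)
  also have "\<dots> = (LINT x:Q|lborel. (g x)\<^sup>2) - (LINT x:Q|lborel. (\<Sum>k\<in>K. 2 * s k * (g x * c k x)))
      + (LINT x:Q|lborel. (\<Sum>k\<in>K. \<Sum>l\<in>K. s k * s l * (c k x * c l x)))"
    by (subst set_integral_add(2), (intro int continuous_intros assms; assumption)+)
       (subst set_integral_diff(2), (intro int continuous_intros assms; assumption)+, simp)
  finally show ?thesis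
    unfolding 1 2 by (simp add: sum_subtractf)
qed

text \<open>The Fourier coefficients give the best approximation: no other coefficients \<open>s\<close> can do better
  than the squared distance on the left.\<close>

lemma least_squares_orthogonal:
  fixes c :: "'k \<Rightarrow> real^'n::finite \<Rightarrow> real"
  assumes "compact Q" and "finite K" and "continuous_on Q g"
    and "\<And>k. k \<in> K \<Longrightarrow> continuous_on Q (c k)"
    and "\<And>k l. k \<in> K \<Longrightarrow> l \<in> K \<Longrightarrow>
      (LINT x:Q|lborel. c k x * c l x) = (if k = l then d k else 0)"
    and d: "\<And>k. k \<in> K \<Longrightarrow> d k > 0"
  shows "(LINT x:Q|lborel. (g x)\<^sup>2) - (\<Sum>k\<in>K. (LINT x:Q|lborel. g x * c k x)\<^sup>2 / d k)
       \<le> (LINT x:Q|lborel. (g x - (\<Sum>k\<in>K. s k * c k x))\<^sup>2)"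
proof -
  have "- (b\<^sup>2 / d k) \<le> (s k)\<^sup>2 * d k - 2 * s k * b" if "k \<in> K" for k b
  proof -
    have "0 \<le> (s k * d k - b)\<^sup>2 / d k" using d[OF that] by simp
    also have "\<dots> = (s k)\<^sup>2 * d k - 2 * s k * b + b\<^sup>2 / d k"
      using d[OF that] by (simp add: field_simps power2_eq_square)
    finally show ?thesis by simp
  qed
  then have "(\<Sum>k\<in>K. - ((LINT x:Q|lborel. g x * c k x)\<^sup>2 / d k))
      \<le> (\<Sum>k\<in>K. (s k)\<^sup>2 * d k - 2 * s k * (LINT x:Q|lborel. g x * c k x))"
    by (rule sum_mono)
  moreover have "(LINT x:Q|lborel. (g x - (\<Sum>k\<in>K. s k * c k x))\<^sup>2)
       = (LINT x:Q|lborel. (g x)\<^sup>2) + (\<Sum>k\<in>K. (s k)\<^sup>2 * d k - 2 * s k * (LINT x:Q|lborel. g x * c k x))"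
    by (rule integral_square_diff_orthogonal[OF assms(1-5)])
  ultimately show ?thesis by (simp add: sum_negf)
qed

lemma Bessel_inequality:
  fixes c :: "'k \<Rightarrow> real^'n::finite \<Rightarrow> real"
  assumes "compact Q" and "finite K" and "continuous_on Q g"
    and "\<And>k. k \<in> K \<Longrightarrow> continuous_on Q (c k)"
    and "\<And>k l. k \<in> K \<Longrightarrow> l \<in> K \<Longrightarrow>
      (LINT x:Q|lborel. c k x * c l x) = (if k = l then d k else 0)"
    and d: "\<And>k. k \<in> K \<Longrightarrow> d k > 0"
  shows "(\<Sum>k\<in>K. (LINT x:Q|lborel. g x * c k x)\<^sup>2 / d k) \<le> (LINT x:Q|lborel. (g x)\<^sup>2)"
proof -
  define s where "s k = (LINT x:Q|lborel. g x * c k x) / d k" for k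
  have "0 \<le> (LINT x:Q|lborel. (g x - (\<Sum>k\<in>K. s k * c k x))\<^sup>2)"
    unfolding set_lebesgue_integral_def by (rule Bochner_Integration.integral_nonneg) simp
  also have "\<dots> = (LINT x:Q|lborel. (g x)\<^sup>2) + (\<Sum>k\<in>K. (s k)\<^sup>2 * d k - 2 * s k * (LINT x:Q|lborel. g x * c k x))"
    by (rule integral_square_diff_orthogonal[OF assms(1-5)])
  also have "(\<Sum>k\<in>K. (s k)\<^sup>2 * d k - 2 * s k * (LINT x:Q|lborel. g x * c k x))
     = (\<Sum>k\<in>K. - ((LINT x:Q|lborel. g x * c k x)\<^sup>2 / d k))"
    by (rule sum.cong[OF refl]) (drule d, simp add: s_def field_simps power2_eq_square)
  finally show ?thesis by (simp add: sum_negf)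
qed

text \<open>The finite linear combinations of the eigenfunctions of the cube.\<close>

definition sine_span :: "real \<Rightarrow> real^'n::finite \<Rightarrow> (real^'n \<Rightarrow> real) set" where
  "sine_span L a = {w. \<exists>K s. finite K \<and> K \<subseteq> {k. \<forall>j. k j \<ge> 1} \<and>
     w = (\<lambda>x. \<Sum>k\<in>K. s k * sine_mode L a k x)}"

lemma sine_span_zero: "(\<lambda>x. 0) \<in> sine_span L a"
  unfolding sine_span_def by (auto intro!: exI[of _ "{}"])

lemma sine_span_scale: "w \<in> sine_span L a \<Longrightarrow> (\<lambda>x. r * w x) \<in> sine_span L a"
proof -
  assume "w \<in> sine_span L a"
  then obtain K s where "finite K" "K \<subseteq> {k. \<forall>j. k j \<ge> 1}" "w = (\<lambda>x. \<Sum>k\<in>K. s k * sine_mode L a k x)"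
    by (auto simp: sine_span_def)
  then show ?thesis unfolding sine_span_def
    by (intro CollectI exI[of _ K] exI[of _ "\<lambda>k. r * s k"]) (simp add: sum_distrib_left mult.assoc)
qed

lemma sine_span_add:
  assumes "v \<in> sine_span L a" and "w \<in> sine_span L a"
  shows "(\<lambda>x. v x + w x) \<in> sine_span L a"
proof -
  obtain K s where K: "finite K" "K \<subseteq> {k. \<forall>j. k j \<ge> 1}" "v = (\<lambda>x. \<Sum>k\<in>K. s k * sine_mode L a k x)"
    using assms(1) by (auto simp: sine_span_def)
  obtain M t where M: "finite M" "M \<subseteq> {k. \<forall>j. k j \<ge> 1}" "w = (\<lambda>x. \<Sum>k\<in>M. t k * sine_mode L a k x)"
    using assms(2) by (auto simp: sine_span_def)
  have "(\<Sum>k\<in>K. s k * sine_mode L a k x) = (\<Sum>k\<in>K \<union> M. (if k \<in> K then s k else 0) * sine_mode L a k x)" for x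
    using K(1) M(1) by (intro sum.mono_neutral_cong_left) auto
  moreover have "(\<Sum>k\<in>M. t k * sine_mode L a k x) = (\<Sum>k\<in>K \<union> M. (if k \<in> M then t k else 0) * sine_mode L a k x)" for x
    using K(1) M(1) by (intro sum.mono_neutral_cong_left) auto
  ultimately show ?thesis unfolding sine_span_def using K M
    by (intro CollectI exI[of _ "K \<union> M"]
        exI[of _ "\<lambda>k. (if k \<in> K then s k else 0) + (if k \<in> M then t k else 0)"])
      (auto simp: distrib_right sum.distrib)
qed

lemma sine_span_sum:
  assumes "\<And>k. k \<in> K \<Longrightarrow> w k \<in> sine_span L a"
  shows "(\<lambda>x. \<Sum>k\<in>K. w k x) \<in> sine_span L a"
  using assms by (induction K rule: infinite_finite_induct) (auto intro!: sine_span_zero sine_span_add)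

lemma sine_mode_eq_0:
  assumes "k j = 0"
  shows "sine_mode L a k = (\<lambda>x. 0)"
proof
  fix x show "sine_mode L a k x = 0"
    unfolding sine_mode_def using assms by (intro prod_zero bexI[of _ j]) auto
qed

lemma sine_mode_in_sine_span: "sine_mode L a k \<in> sine_span L a"
proof (cases "\<forall>j. k j \<ge> 1")
  case True
  then show ?thesis unfolding sine_span_def
    by (intro CollectI exI[of _ "{k}"] exI[of _ "\<lambda>_. 1"]) (auto simp: fun_eq_iff)
next
  case False
  then obtain j where "k j = 0" by (auto simp: not_le)
  then show ?thesis by (simp add: sine_mode_eq_0 sine_span_zero)
qed

text \<open>The span of the sine products is a module over the algebra generated by the functions
  \<open>cos (\<pi> (x\<^sub>i - a\<^sub>i) / L)\<close>, because \<open>2 cos y sin (k y) = sin ((k + 1) y) + sin ((k - 1) y)\<close>.\<close>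

lemma cos_times_sine_mode_in_sine_span:
  "(\<lambda>x. cos (pi / L * (x $ i - a $ i)) * sine_mode L a k x) \<in> sine_span L a"
proof (cases "k i = 0")
  case True
  then show ?thesis by (simp add: sine_mode_eq_0 sine_span_zero)
next
  case False
  have split: "sine_mode L a (k(i := m)) x = sin (real m * (pi / L) * (x $ i - a $ i)) *
     (\<Prod>j\<in>UNIV - {i}. sin (real (k j) * (pi / L) * (x $ j - a $ j)))" for m x
    unfolding sine_mode_def by (subst prod.remove[of UNIV i]) (auto intro!: prod.cong)
  have "cos (pi / L * (x $ i - a $ i)) * sine_mode L a k x
    = 1 / 2 * sine_mode L a (k(i := k i + 1)) x + 1 / 2 * sine_mode L a (k(i := k i - 1)) x" for x
  proof -
    define y where "y = pi / L * (x $ i - a $ i)"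
    have 1: "real m * (pi / L) * (x $ i - a $ i) = real m * y" for m by (simp add: y_def)
    have 2: "cos y * sin (real (k i) * y) = 1 / 2 * sin (real (k i + 1) * y) + 1 / 2 * sin (real (k i - 1) * y)"
      using False by (simp add: of_nat_diff distrib_right left_diff_distrib sin_add sin_diff field_simps)
    show ?thesis
      using split[of "k i" x] unfolding split 1 y_def[symmetric] fun_upd_triv
      by (simp add: mult.assoc[symmetric] 2 distrib_right)
  qed
  then show ?thesis
    by (simp only:) (intro sine_span_add sine_span_scale sine_mode_in_sine_span)
qed

lemma sine_mode_first_pos:
  assumes "L > 0" and "x \<in> box a (\<chi> j. a $ j + L)"
  shows "sine_mode L a (\<lambda>_. 1) x > 0"
  unfolding sine_mode_def
proof (rule prod_pos)
  fix j
  have "0 < x $ j - a $ j" "x $ j - a $ j < L"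
    using assms(2) by (auto simp: mem_box_cart algebra_simps)
  then have "0 < pi * ((x $ j - a $ j) / L)" "pi * ((x $ j - a $ j) / L) < pi * 1"
    using assms(1) by (intro mult_pos_pos mult_strict_left_mono; simp)+
  then show "0 < sin (real 1 * (pi / L) * (x $ j - a $ j))"
    using sin_gt_zero by (simp add: mult.assoc)
qed

lemma abs_sine_mode_le_1: "\<bar>sine_mode L a k x\<bar> \<le> 1"
  unfolding sine_mode_def abs_prod by (rule prod_le_1) auto

text \<open>Completeness of the sine products. The cosines of the coordinates separate the points of the
  closed cube, so Stone--Weierstrass approximates \<open>f / \<psi>\<close> uniformly by polynomials in them, where
  \<open>\<psi>\<close> is the first eigenfunction; multiplying by \<open>\<psi>\<close> leads back into the span. The compact support
  of \<open>f\<close> in the open cube makes the quotient continuous.\<close>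

lemma sine_span_dense:
  fixes f :: "real^'n::finite \<Rightarrow> real"
  assumes "L > 0" and "compact K" and K: "K \<subseteq> box a (\<chi> j. a $ j + L)"
    and f: "continuous_on UNIV f" and f0: "\<And>x. x \<notin> K \<Longrightarrow> f x = 0" and "e > 0"
  obtains w where "w \<in> sine_span L a" and "\<And>x. x \<in> cbox a (\<chi> j. a $ j + L) \<Longrightarrow> \<bar>f x - w x\<bar> \<le> e"
proof -
  let ?Q = "cbox a (\<chi> j. a $ j + L)" and ?B = "box a (\<chi> j. a $ j + L)"
  let ?psi = "sine_mode L a (\<lambda>_. 1)"
  \<comment> \<open>the multipliers of the span; they form an algebra, to which Stone--Weierstrass is applied\<close>
  define P where "P g \<longleftrightarrow> continuous_on ?Q g \<and> (\<forall>k. (\<lambda>x. g x * sine_mode L a k x) \<in> sine_span L a)" for g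
  define g where "g x = (if x \<in> ?B then f x / ?psi x else 0)" for x
  have "continuous_on UNIV g" unfolding g_def[abs_def]
  proof (rule continuous_on_extend_by_zero[OF open_box assms(2) K])
    show "continuous_on ?B (\<lambda>x. f x / ?psi x)"
      using sine_mode_first_pos[OF assms(1)] f
      by (intro continuous_intros) (force intro: continuous_on_subset)+
  qed (simp add: f0)
  then have "continuous_on ?Q g" by (rule continuous_on_subset) simp
  moreover have "P (\<lambda>x. c)" for c
    by (auto simp: P_def intro!: sine_span_scale sine_mode_in_sine_span)
  moreover have "P (\<lambda>x. f1 x + f2 x)" if "P f1 \<and> P f2" for f1 f2
    using that by (auto simp: P_def distrib_right intro!: sine_span_add continuous_intros)
  moreover have "P (\<lambda>x. f1 x * f2 x)" if P: "P f1 \<and> P f2" for f1 f2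
  proof -
    have "(\<lambda>x. f1 x * f2 x * sine_mode L a k x) \<in> sine_span L a" for k
    proof -
      from P obtain M t where *: "(\<lambda>x. f2 x * sine_mode L a k x) = (\<lambda>x. \<Sum>l\<in>M. t l * sine_mode L a l x)"
        unfolding P_def sine_span_def by blast
      have "f1 x * f2 x * sine_mode L a k x = (\<Sum>l\<in>M. t l * (f1 x * sine_mode L a l x))" for x
        using fun_cong[OF *, of x] by (simp add: mult.assoc sum_distrib_left mult.left_commute)
      moreover have "(\<lambda>x. \<Sum>l\<in>M. t l * (f1 x * sine_mode L a l x)) \<in> sine_span L a"
        using P by (auto simp: P_def intro!: sine_span_sum sine_span_scale)
      ultimately show ?thesis by simp
    qed
    with P show ?thesis by (auto simp: P_def intro!: continuous_intros)
  qed
  moreover have "\<exists>h. P h \<and> h x \<noteq> h y" if xy: "x \<in> ?Q \<and> y \<in> ?Q \<and> x \<noteq> y" for x y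
  proof -
    from xy obtain i where i: "x $ i \<noteq> y $ i" by (auto simp: vec_eq_iff)
    have r: "0 \<le> pi / L * (z $ i - a $ i) \<and> pi / L * (z $ i - a $ i) \<le> pi" if "z \<in> ?Q" for z
    proof -
      have "0 \<le> z $ i - a $ i" "z $ i - a $ i \<le> L"
        using that by (auto simp: mem_box_cart algebra_simps)
      then have "0 \<le> pi * ((z $ i - a $ i) / L)" "pi * ((z $ i - a $ i) / L) \<le> pi * 1"
        using assms(1) by (intro mult_nonneg_nonneg mult_left_mono; simp)+
      then show ?thesis by simp
    qed
    have "pi / L * (x $ i - a $ i) \<noteq> pi / L * (y $ i - a $ i)"
      using i assms(1) by simp
    then have "cos (pi / L * (x $ i - a $ i)) \<noteq> cos (pi / L * (y $ i - a $ i))"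
      using r xy cos_inj_pi by blast
    moreover have "P (\<lambda>x. cos (pi / L * (x $ i - a $ i)))"
      unfolding P_def
      by (intro conjI allI cos_times_sine_mode_in_sine_span continuous_on_cos continuous_on_mult
          continuous_on_const continuous_on_diff continuous_on_component continuous_on_id)
    ultimately show ?thesis by (intro exI[of _ "\<lambda>x. cos (pi / L * (x $ i - a $ i))"]) simp
  qed
  ultimately obtain p where p: "P p" "\<And>x. x \<in> ?Q \<Longrightarrow> \<bar>g x - p x\<bar> < e"
    using Stone_Weierstrass_HOL[of ?Q P g e] assms(6) by (force simp: P_def)
  show thesis
  proof
    show "(\<lambda>x. p x * ?psi x) \<in> sine_span L a" using p(1) by (simp add: P_def)
    fix x assume x: "x \<in> ?Q"
    have "f x = g x * ?psi x"
    proof (cases "x \<in> ?B")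
      case True
      then show ?thesis using sine_mode_first_pos[OF assms(1) True] by (simp add: g_def)
    next
      case False
      then show ?thesis using f0[of x] K by (auto simp: g_def)
    qed
    then have "\<bar>f x - p x * ?psi x\<bar> = \<bar>g x - p x\<bar> * \<bar>?psi x\<bar>"
      by (simp add: abs_mult[symmetric] algebra_simps)
    also have "\<dots> \<le> e * 1"
      using p(2)[OF x] abs_sine_mode_le_1[of L a "\<lambda>_. 1" x] by (intro mult_mono) auto
    finally show "\<bar>f x - p x * ?psi x\<bar> \<le> e" by simp
  qed
qed

section \<open>Lower bounds for the Dirichlet energy in a cube\<close>

lemma has_partial_on_sine_mode_deriv:
  "has_partial_on S i (sine_mode_deriv L a i k) (\<lambda>x. - ((real (k i) * (pi / L))\<^sup>2) * sine_mode L a k x)"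
proof -
  have *: "((\<lambda>t. c * (cos (c * (x $ i + t - a $ i)) * P)) has_real_derivative
      - (c\<^sup>2) * (sin (c * (x $ i - a $ i)) * P)) (at 0)" for c P and x :: "real^'a"
    by (auto intro!: derivative_eq_intros simp: power2_eq_square)
  have "(\<Prod>j\<in>UNIV. (if j = i then cos else sin) (real (k j) * (pi / L) * ((x + t *\<^sub>R axis i 1) $ j - a $ j)))
     = cos (real (k i) * (pi / L) * (x $ i + t - a $ i)) *
       (\<Prod>j\<in>UNIV - {i}. sin (real (k j) * (pi / L) * (x $ j - a $ j)))" for x t
    by (subst prod.remove[of UNIV i]) (auto simp: axis_def intro!: prod.cong)
  moreover have "(\<Prod>j\<in>UNIV. sin (real (k j) * (pi / L) * (x $ j - a $ j)))
     = sin (real (k i) * (pi / L) * (x $ i - a $ i)) *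
       (\<Prod>j\<in>UNIV - {i}. sin (real (k j) * (pi / L) * (x $ j - a $ j)))" for x
    by (subst prod.remove[of UNIV i]) (auto intro!: prod.cong)
  ultimately show ?thesis
    unfolding has_partial_on_def sine_mode_def sine_mode_deriv_def by (simp only: *) simp
qed

text \<open>The coefficient of \<open>\<partial>\<^sub>i f\<close> with respect to \<open>\<partial>\<^sub>i e\<^sub>k\<close> is the eigenvalue contribution
  \<open>(k\<^sub>i \<pi> / L)\<^sup>2\<close> times the coefficient of \<open>f\<close> with respect to \<open>e\<^sub>k\<close>.\<close>

lemma integral_mode_coefficient:
  assumes "open S" and "compact K" and "K \<subseteq> S"
    and "continuous_on S f" and "\<And>x. x \<in> S - K \<Longrightarrow> f x = 0"
    and "continuous_on S g" and "has_partial_on S i f g"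
  shows "(LINT x:S|lborel. g x * sine_mode_deriv L a i k x)
       = (real (k i) * (pi / L))\<^sup>2 * (LINT x:S|lborel. f x * sine_mode L a k x)"
proof -
  define c where "c = (real (k i) * (pi / L))\<^sup>2"
  have g0: "g x = 0" if "x \<in> S - K" for x
    using has_partial_on_extend_by_zero(2)[OF assms(1-3,7,5)] that by auto
  have "(LINT x:S|lborel. g x * sine_mode_deriv L a i k x + f x * (- c * sine_mode L a k x)) = 0"
    unfolding c_def
    by (rule integral_partial_eq_0(2)[OF assms(1-3) _ _
          has_partial_on_mult[OF assms(7) has_partial_on_sine_mode_deriv]])
       (use assms(4-6) in \<open>auto intro!: continuous_intros\<close>)
  moreover have "set_integrable lborel S (\<lambda>x. g x * sine_mode_deriv L a i k x)"
    by (rule set_integrable_continuous_compact_support[OF _ assms(2,3)])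
       (use assms(6) g0 in \<open>auto intro!: continuous_intros\<close>)
  moreover have "set_integrable lborel S (\<lambda>x. f x * (- c * sine_mode L a k x))"
    by (rule set_integrable_continuous_compact_support[OF _ assms(2,3)])
       (use assms(4,5) in \<open>auto intro!: continuous_intros\<close>)
  ultimately have "(LINT x:S|lborel. g x * sine_mode_deriv L a i k x)
      + (LINT x:S|lborel. f x * (- c * sine_mode L a k x)) = 0"
    by (subst set_integral_add(2)[symmetric])
  moreover have "(LINT x:S|lborel. f x * (- c * sine_mode L a k x))
      = - c * (LINT x:S|lborel. f x * sine_mode L a k x)"
    unfolding set_integral_mult_right[symmetric]
    by (rule arg_cong[where f="set_lebesgue_integral _ _"]) (auto simp: fun_eq_iff)
  ultimately show ?thesis by (simp add: c_def)
qed

lemma set_integral_extend_by_zero: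
  fixes h :: "real^'n::finite \<Rightarrow> real"
  assumes "S \<subseteq> Q" and "\<And>x. x \<in> S \<Longrightarrow> h x = h' x" and "\<And>x. x \<in> Q - S \<Longrightarrow> h x = 0"
  shows "(LINT x:Q|lborel. h x) = (LINT x:S|lborel. h' x)"
proof -
  have "(\<lambda>x. indicator Q x *\<^sub>R h x) = (\<lambda>x. indicator S x *\<^sub>R h' x)"
    using assms by (fastforce simp: indicator_def fun_eq_iff)
  then show ?thesis by (simp add: set_lebesgue_integral_def)
qed

text \<open>The two lowest Dirichlet eigenvalues of the cube, in units of \<open>(\<pi> / L)\<^sup>2\<close>: the value \<open>n\<close>
  belongs to \<open>k = (1, \<dots>, 1)\<close>, and every other multi-index has an entry at least 2.\<close>

lemma sum_squares_multi_index:
  fixes k :: "'n::finite \<Rightarrow> nat"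
  assumes "\<And>j. k j \<ge> 1"
  shows "real CARD('n) \<le> (\<Sum>j\<in>UNIV. (real (k j))\<^sup>2)"
    and "k \<noteq> (\<lambda>_. 1) \<Longrightarrow> real CARD('n) + 3 \<le> (\<Sum>j\<in>UNIV. (real (k j))\<^sup>2)"
proof -
  have one: "1 \<le> (real (k j))\<^sup>2" for j
    using assms[of j] by (simp add: one_le_power)
  show "real CARD('n) \<le> (\<Sum>j\<in>UNIV. (real (k j))\<^sup>2)"
    using sum_mono[of UNIV "\<lambda>_. 1" "\<lambda>j. (real (k j))\<^sup>2"] one by simp
  assume "k \<noteq> (\<lambda>_. 1)"
  then obtain i where "k i \<noteq> 1" by auto
  with assms[of i] have "2 \<le> real (k i)" by simp
  then have "2\<^sup>2 \<le> (real (k i))\<^sup>2" by (rule power_mono) simp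
  moreover have "(\<Sum>j\<in>UNIV - {i}. (1::real)) \<le> (\<Sum>j\<in>UNIV - {i}. (real (k j))\<^sup>2)"
    using one by (intro sum_mono) auto
  moreover have "(\<Sum>j\<in>UNIV - {i}. (1::real)) = real CARD('n) - 1"
    by (simp add: card_Diff_singleton of_nat_diff Suc_leI)
  moreover have "(\<Sum>j\<in>UNIV. (real (k j))\<^sup>2) = (real (k i))\<^sup>2 + (\<Sum>j\<in>UNIV - {i}. (real (k j))\<^sup>2)"
    by (rule sum.remove) auto
  ultimately show "real CARD('n) + 3 \<le> (\<Sum>j\<in>UNIV. (real (k j))\<^sup>2)" by simp
qed

text \<open>Parseval up to an arbitrary error \<open>\<delta>\<close> for \<open>f\<close>, and Bessel for its partial derivatives, over the
  same finite set of modes. The factor \<open>(2 / L)\<^sup>n\<close> is the reciprocal of the squared norm of a mode.\<close>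

lemma dirichlet_energy_modes:
  fixes f :: "real^'n::finite \<Rightarrow> real" and a :: "real^'n"
  assumes "L > 0" and "open S" and SQ: "S \<subseteq> cbox a (\<chi> j. a $ j + L)"
    and "compact K" and "K \<subseteq> S"
    and f: "continuous_on S f" "\<And>x. x \<in> S - K \<Longrightarrow> f x = 0"
    and g: "\<And>i. continuous_on S (g i)" "\<And>i. has_partial_on S i f (g i)"
    and "\<delta> > 0"
  obtains M where "finite M" and "M \<subseteq> {k. \<forall>j. k j \<ge> 1}"
    and "(LINT x:S|lborel. (f x)\<^sup>2) - \<delta>
      \<le> (2 / L) ^ CARD('n) * (\<Sum>k\<in>M. (LINT x:S|lborel. f x * sine_mode L a k x)\<^sup>2)"
    and "(pi / L)\<^sup>2 * (2 / L) ^ CARD('n) *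
        (\<Sum>k\<in>M. (\<Sum>i\<in>UNIV. (real (k i))\<^sup>2) * (LINT x:S|lborel. f x * sine_mode L a k x)\<^sup>2)
      \<le> (\<Sum>i\<in>UNIV. LINT x:S|lborel. (g i x)\<^sup>2)"
proof -
  let ?Q = "cbox a (\<chi> j. a $ j + L)"
  define N where "N = (L / 2) ^ CARD('n)"
  have N: "N > 0" "(2 / L) ^ CARD('n) = 1 / N"
    using assms(1) by (auto simp: N_def power_divide)
  define b where "b k = (LINT x:S|lborel. f x * sine_mode L a k x)" for k
  define F where "F x = (if x \<in> S then f x else 0)" for x
  define G where "G i x = (if x \<in> S then g i x else 0)" for i x
  have g0: "g i x = 0" if "x \<in> S - K" for i x
    using has_partial_on_extend_by_zero(2)[OF assms(2,4,5) g(2) f(2)] that by auto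
  have cF: "continuous_on UNIV F" and cG: "continuous_on UNIV (G i)" for i
    unfolding F_def[abs_def] G_def[abs_def] using assms(2,4,5) f g(1) g0
    by (auto intro!: continuous_on_extend_by_zero)
  have cF': "continuous_on ?Q F" and cG': "continuous_on ?Q (G i)" for i
    using cF cG by (auto intro: continuous_on_subset)
  have KB: "K \<subseteq> box a (\<chi> j. a $ j + L)"
    using interior_maximal[OF SQ assms(2)] assms(5) by auto
  have F0: "F x = 0" if "x \<notin> K" for x using f(2) that by (auto simp: F_def)
  define V where "V = (LINT x:?Q|lborel. (1::real))"
  have V: "V \<ge> 0" unfolding V_def set_lebesgue_integral_def by (rule Bochner_Integration.integral_nonneg) simp
  define e where "e = sqrt (\<delta> / (V + 1))"
  have e: "e > 0" "e\<^sup>2 * V \<le> \<delta>"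
    using V \<open>\<delta> > 0\<close> by (auto simp: e_def field_simps)
  obtain w where w: "w \<in> sine_span L a" "\<And>x. x \<in> ?Q \<Longrightarrow> \<bar>F x - w x\<bar> \<le> e"
    using sine_span_dense[OF assms(1,4) KB cF F0 e(1)] by blast
  then obtain M s where M: "finite M" "M \<subseteq> {k. \<forall>j. k j \<ge> 1}"
      and ws: "w = (\<lambda>x. \<Sum>k\<in>M. s k * sine_mode L a k x)"
    by (auto simp: sine_span_def)
  have bF: "(LINT x:?Q|lborel. F x * sine_mode L a k x) = b k" for k
    unfolding b_def by (rule set_integral_extend_by_zero[OF SQ]) (auto simp: F_def)
  have bG: "(LINT x:?Q|lborel. G i x * sine_mode_deriv L a i k x) = (real (k i) * (pi / L))\<^sup>2 * b k" for i k
  proof -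
    have "(LINT x:?Q|lborel. G i x * sine_mode_deriv L a i k x)
        = (LINT x:S|lborel. g i x * sine_mode_deriv L a i k x)"
      by (rule set_integral_extend_by_zero[OF SQ]) (auto simp: G_def)
    then show ?thesis
      using integral_mode_coefficient[OF assms(2,4,5) f g(1) g(2), of i] by (simp add: b_def)
  qed
  have F2: "(LINT x:?Q|lborel. (F x)\<^sup>2) = (LINT x:S|lborel. (f x)\<^sup>2)"
    by (rule set_integral_extend_by_zero[OF SQ]) (auto simp: F_def)
  have G2: "(LINT x:?Q|lborel. (G i x)\<^sup>2) = (LINT x:S|lborel. (g i x)\<^sup>2)" for i
    by (rule set_integral_extend_by_zero[OF SQ]) (auto simp: G_def)
  have "(LINT x:?Q|lborel. (F x)\<^sup>2) - (\<Sum>k\<in>M. (LINT x:?Q|lborel. F x * sine_mode L a k x)\<^sup>2 / N)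
      \<le> (LINT x:?Q|lborel. (F x - (\<Sum>k\<in>M. s k * sine_mode L a k x))\<^sup>2)"
  proof (rule least_squares_orthogonal[OF compact_cbox M(1) cF'])
    fix k l assume "k \<in> M" "l \<in> M"
    with M(2) show "(LINT x:?Q|lborel. sine_mode L a k x * sine_mode L a l x) = (if k = l then N else 0)"
      unfolding N_def by (intro integral_sine_mode_sine_mode[OF assms(1)]) auto
  qed (auto intro!: continuous_on_sine_mode N)
  also have "\<dots> \<le> (LINT x:?Q|lborel. e\<^sup>2 * 1)"
  proof (rule set_integral_mono)
    show "set_integrable lborel ?Q (\<lambda>x. (F x - (\<Sum>k\<in>M. s k * sine_mode L a k x))\<^sup>2)"
      by (intro set_integrable_continuous_compact compact_cbox continuous_intros cF')
    show "set_integrable lborel ?Q (\<lambda>x. e\<^sup>2 * 1)"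
      by (intro set_integrable_continuous_compact compact_cbox continuous_intros)
    show "(F x - (\<Sum>k\<in>M. s k * sine_mode L a k x))\<^sup>2 \<le> e\<^sup>2 * 1" if "x \<in> ?Q" for x
      using w(2)[OF that] e(1) by (simp add: ws abs_le_square_iff[symmetric])
  qed
  also have "\<dots> = e\<^sup>2 * V" unfolding V_def by (rule set_integral_mult_right)
  finally have 1: "(LINT x:S|lborel. (f x)\<^sup>2) - \<delta> \<le> (\<Sum>k\<in>M. (b k)\<^sup>2) / N"
    using e(2) unfolding bF F2 by (simp add: sum_divide_distrib)
  have 2: "(pi / L)\<^sup>2 / N * (\<Sum>k\<in>M. (real (k i))\<^sup>2 * (b k)\<^sup>2) \<le> (LINT x:S|lborel. (g i x)\<^sup>2)" for i
  proof -
    define d where "d k = (real (k i) * (pi / L))\<^sup>2 * N" for k :: "'n \<Rightarrow> nat"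
    have kpos: "real (k i) > 0" if "k \<in> M" for k using M(2) that by (auto simp: Suc_le_eq)
    have "(\<Sum>k\<in>M. (LINT x:?Q|lborel. G i x * sine_mode_deriv L a i k x)\<^sup>2 / d k)
        \<le> (LINT x:?Q|lborel. (G i x)\<^sup>2)"
    proof (rule Bessel_inequality[OF compact_cbox M(1) cG'])
      fix k l assume "k \<in> M" "l \<in> M"
      with M(2) show "(LINT x:?Q|lborel. sine_mode_deriv L a i k x * sine_mode_deriv L a i l x) = (if k = l then d k else 0)"
        unfolding N_def d_def by (intro integral_sine_mode_deriv_sine_mode_deriv[OF assms(1)]) auto
    next
      fix k assume "k \<in> M"
      then show "d k > 0" using kpos[of k] assms(1) N by (simp add: d_def)
    qed (auto intro!: continuous_on_sine_mode_deriv)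
    also have "(\<Sum>k\<in>M. (LINT x:?Q|lborel. G i x * sine_mode_deriv L a i k x)\<^sup>2 / d k)
       = (pi / L)\<^sup>2 / N * (\<Sum>k\<in>M. (real (k i))\<^sup>2 * (b k)\<^sup>2)"
      unfolding bG sum_distrib_left
    proof (rule sum.cong[OF refl])
      fix k assume k: "k \<in> M"
      have "0 < real (k i) * (pi / L)" using kpos[OF k] assms(1) by simp
      then show "((real (k i) * (pi / L))\<^sup>2 * b k)\<^sup>2 / d k = (pi / L)\<^sup>2 / N * ((real (k i))\<^sup>2 * (b k)\<^sup>2)"
        using N(1) unfolding d_def by (simp add: field_simps power2_eq_square)
    qed
    finally show ?thesis unfolding G2 .
  qed
  have "(pi / L)\<^sup>2 / N * (\<Sum>k\<in>M. (\<Sum>i\<in>UNIV. (real (k i))\<^sup>2) * (b k)\<^sup>2)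
      = (\<Sum>i\<in>UNIV. (pi / L)\<^sup>2 / N * (\<Sum>k\<in>M. (real (k i))\<^sup>2 * (b k)\<^sup>2))"
    unfolding sum_distrib_left sum_distrib_right by (rule sum.swap)
  also have "\<dots> \<le> (\<Sum>i\<in>UNIV. LINT x:S|lborel. (g i x)\<^sup>2)"
    by (intro sum_mono 2)
  finally show thesis
    using that[OF M] 1 unfolding N(2) b_def by simp
qed

text \<open>Variational bounds by the eigenvalues of the cube for functions compactly supported in it. The
  second bound is that of the second eigenvalue for functions orthogonal to the first eigenfunction;
  it is stated with a correction term since truncations of an orthogonal function are orthogonal
  only in the limit.\<close>

lemma dirichlet_energy_lower_bounds:
  fixes f :: "real^'n::finite \<Rightarrow> real" and a :: "real^'n"
  assumes "L > 0" and "open S" and "S \<subseteq> cbox a (\<chi> j. a $ j + L)"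
    and "compact K" and "K \<subseteq> S"
    and "continuous_on S f" and "\<And>x. x \<in> S - K \<Longrightarrow> f x = 0"
    and "\<And>i. continuous_on S (g i)" and "\<And>i. has_partial_on S i f (g i)"
  shows "real CARD('n) * (pi / L)\<^sup>2 * (LINT x:S|lborel. (f x)\<^sup>2)
      \<le> (\<Sum>i\<in>UNIV. LINT x:S|lborel. (g i x)\<^sup>2)" (is "?A \<le> ?E")
    and "(real CARD('n) + 3) * (pi / L)\<^sup>2 * (LINT x:S|lborel. (f x)\<^sup>2)
      - 3 * (pi / L)\<^sup>2 * (2 / L) ^ CARD('n) * (LINT x:S|lborel. f x * sine_mode L a (\<lambda>_. 1) x)\<^sup>2
      \<le> (\<Sum>i\<in>UNIV. LINT x:S|lborel. (g i x)\<^sup>2)" (is "?B \<le> ?E")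
proof -
  let ?n = "real CARD('n)"
  define b where "b k = (LINT x:S|lborel. f x * sine_mode L a k x)" for k
  define I where "I = (LINT x:S|lborel. (f x)\<^sup>2)"
  define \<kappa> where "\<kappa> = (pi / L)\<^sup>2"
  define \<nu> where "\<nu> = (2 / L) ^ CARD('n)"
  have pos: "\<kappa> > 0" "\<nu> > 0" using assms(1) by (auto simp: \<kappa>_def \<nu>_def)
  have main: "?n * \<kappa> * (I - \<delta>) \<le> ?E \<and> (?n + 3) * \<kappa> * (I - \<delta>) - 3 * \<kappa> * \<nu> * (b (\<lambda>_. 1))\<^sup>2 \<le> ?E"
    if \<delta>: "\<delta> > 0" for \<delta>
  proof -
    obtain M where M: "finite M" "M \<subseteq> {k. \<forall>j. k j \<ge> 1}"
      "I - \<delta> \<le> \<nu> * (\<Sum>k\<in>M. (b k)\<^sup>2)"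
      "\<kappa> * \<nu> * (\<Sum>k\<in>M. (\<Sum>i\<in>UNIV. (real (k i))\<^sup>2) * (b k)\<^sup>2) \<le> ?E"
      by (rule dirichlet_energy_modes[OF assms \<delta>, folded b_def I_def \<kappa>_def \<nu>_def])
    have low1: "?n * (\<Sum>k\<in>M. (b k)\<^sup>2) \<le> (\<Sum>k\<in>M. (\<Sum>i\<in>UNIV. (real (k i))\<^sup>2) * (b k)\<^sup>2)"
      unfolding sum_distrib_left
    proof (rule sum_mono)
      fix k assume "k \<in> M"
      then have "\<And>j. k j \<ge> 1" using M(2) by auto
      then show "?n * (b k)\<^sup>2 \<le> (\<Sum>i\<in>UNIV. (real (k i))\<^sup>2) * (b k)\<^sup>2"
        by (rule mult_right_mono[OF sum_squares_multi_index(1)]) simp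
    qed
    have "\<kappa> * \<nu> * (?n * (\<Sum>k\<in>M. (b k)\<^sup>2)) \<le> ?E"
      by (rule order_trans[OF mult_left_mono[OF low1] M(4)]) (use pos in simp)
    moreover have "?n * \<kappa> * (I - \<delta>) \<le> ?n * \<kappa> * (\<nu> * (\<Sum>k\<in>M. (b k)\<^sup>2))"
      using M(3) pos by (intro mult_left_mono) auto
    moreover have low2: "(?n + 3) * (\<Sum>k\<in>M. (b k)\<^sup>2) - 3 * (b (\<lambda>_. 1))\<^sup>2
        \<le> (\<Sum>k\<in>M. (\<Sum>i\<in>UNIV. (real (k i))\<^sup>2) * (b k)\<^sup>2)"
    proof -
      have "(\<Sum>k\<in>M. (?n + 3) * (b k)\<^sup>2)
          \<le> (\<Sum>k\<in>M. (\<Sum>i\<in>UNIV. (real (k i))\<^sup>2) * (b k)\<^sup>2 + (if k = (\<lambda>_. 1) then 3 * (b k)\<^sup>2 else 0))"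
      proof (rule sum_mono)
        fix k assume "k \<in> M"
        then have k: "\<And>j. k j \<ge> 1" using M(2) by auto
        show "(?n + 3) * (b k)\<^sup>2
            \<le> (\<Sum>i\<in>UNIV. (real (k i))\<^sup>2) * (b k)\<^sup>2 + (if k = (\<lambda>_. 1) then 3 * (b k)\<^sup>2 else 0)"
          using mult_right_mono[OF sum_squares_multi_index(2)[OF k], where c="(b k)\<^sup>2"]
          by (auto simp: distrib_right)
      qed
      also have "\<dots> \<le> (\<Sum>k\<in>M. (\<Sum>i\<in>UNIV. (real (k i))\<^sup>2) * (b k)\<^sup>2) + 3 * (b (\<lambda>_. 1))\<^sup>2"
        using M(1) by (simp add: sum.distrib)
      finally show ?thesis by (simp add: sum_distrib_left)
    qed
    have "\<kappa> * \<nu> * ((?n + 3) * (\<Sum>k\<in>M. (b k)\<^sup>2) - 3 * (b (\<lambda>_. 1))\<^sup>2) \<le> ?E"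
      by (rule order_trans[OF mult_left_mono[OF low2] M(4)]) (use pos in simp)
    moreover have "(?n + 3) * \<kappa> * (I - \<delta>) \<le> (?n + 3) * \<kappa> * (\<nu> * (\<Sum>k\<in>M. (b k)\<^sup>2))"
      using M(3) pos by (intro mult_left_mono) auto
    ultimately show ?thesis by (auto simp: algebra_simps)
  qed
  have lim: "X \<le> ?E" if "\<And>\<delta>. \<delta> > 0 \<Longrightarrow> X - c * \<delta> \<le> ?E" and "c > 0" for X c
  proof (rule field_le_epsilon)
    fix e :: real assume "e > 0"
    with that(1)[of "e / c"] that(2) show "X \<le> ?E + e" by simp
  qed
  have "?A \<le> ?E"
  proof (rule lim)
    show "?A - ?n * \<kappa> * \<delta> \<le> ?E" if "\<delta> > 0" for \<delta>
      using main[OF that] unfolding I_def[symmetric] \<kappa>_def[symmetric] by (simp add: algebra_simps)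
    show "?n * \<kappa> > 0" using pos by simp
  qed
  moreover have "?B \<le> ?E"
  proof (rule lim)
    show "?B - (?n + 3) * \<kappa> * \<delta> \<le> ?E" if "\<delta> > 0" for \<delta>
      using main[OF that] unfolding I_def[symmetric] \<kappa>_def[symmetric] b_def[symmetric] \<nu>_def[symmetric]
      by (simp add: algebra_simps)
    show "(?n + 3) * \<kappa> > 0" using pos by simp
  qed
  ultimately show "?A \<le> ?E" "?B \<le> ?E" by auto
qed

section \<open>The cutoff function and auxiliary facts on integrals\<close>

text \<open>For \<open>e > 0\<close>, a \<open>C\<^sup>1\<close> cutoff that vanishes for \<open>r \<le> e\<close> and equals \<open>(1 - e / r)\<^sup>2\<close> beyond. The scale-invariant
  bound \<open>r * cutoff_deriv e r \<le> 1\<close>, together with the pointwise convergence to \<open>0\<close> as \<open>e\<close> tends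
  to \<open>0\<close>, is what makes the truncation errors vanish. Writing \<open>max e r\<close> makes continuity evident.\<close>

definition cutoff :: "real \<Rightarrow> real \<Rightarrow> real" where
  "cutoff e r = (1 - e / max e r)\<^sup>2"

text \<open>The derivative of \<^const>\<open>cutoff\<close>.\<close>

definition cutoff_deriv :: "real \<Rightarrow> real \<Rightarrow> real" where
  "cutoff_deriv e r = 2 * (1 - e / max e r) * (e / (max e r)\<^sup>2)"

lemma cutoff_eq_0: "e > 0 \<Longrightarrow> r \<le> e \<Longrightarrow> cutoff e r = 0"
  by (simp add: cutoff_def)

lemma cutoff_deriv_eq_0: "e > 0 \<Longrightarrow> r \<le> e \<Longrightarrow> cutoff_deriv e r = 0"
  by (simp add: cutoff_deriv_def)

lemma cutoff_bounds:
  assumes "e > 0"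
  shows "0 \<le> cutoff e r" and "cutoff e r \<le> 1"
proof -
  have "0 < e / max e r" "e / max e r \<le> 1" using assms by (auto simp: divide_simps)
  then show "0 \<le> cutoff e r" "cutoff e r \<le> 1" by (auto simp: cutoff_def power_le_one)
qed

lemma cutoff_deriv_bounds:
  assumes "e > 0" and "r \<ge> 0"
  shows "0 \<le> cutoff_deriv e r" and "r * cutoff_deriv e r \<le> 1"
proof -
  define y where "y = e / max e r"
  have y: "0 < y" "y \<le> 1" using assms by (auto simp: y_def divide_simps)
  have d: "cutoff_deriv e r = 2 * (1 - y) * (y / max e r)"
    by (simp add: cutoff_deriv_def y_def power2_eq_square)
  show "0 \<le> cutoff_deriv e r" using y assms by (simp add: d)
  have "r * cutoff_deriv e r \<le> max e r * cutoff_deriv e r"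
    using \<open>0 \<le> cutoff_deriv e r\<close> by (intro mult_right_mono) auto
  also have "\<dots> = 2 * (1 - y) * y" using assms by (simp add: d)
  also have "\<dots> \<le> 1"
  proof -
    have "0 \<le> (1 - 2 * y)\<^sup>2" by simp
    also have "\<dots> = 1 - 2 * (2 * (1 - y) * y)" by (simp add: power2_eq_square algebra_simps)
    finally show ?thesis by linarith
  qed
  finally show "r * cutoff_deriv e r \<le> 1" .
qed

lemma continuous_on_cutoff: "e > 0 \<Longrightarrow> continuous_on S (cutoff e)"
  unfolding cutoff_def[abs_def] by (intro continuous_intros) auto

lemma continuous_on_cutoff_deriv: "e > 0 \<Longrightarrow> continuous_on S (cutoff_deriv e)"
  unfolding cutoff_deriv_def[abs_def] by (intro continuous_intros) auto

lemma DERIV_max_0_square: "((\<lambda>y::real. (max 0 y)\<^sup>2) has_real_derivative 2 * max 0 y) (at y)"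
proof -
  consider "y < 0" | "y > 0" | "y = 0" by linarith
  then show ?thesis
  proof cases
    case 1
    then have ev: "\<forall>\<^sub>F z in nhds y. (max 0 z)\<^sup>2 = 0"
      using eventually_nhds_in_open[of "{..<0}" y] by (auto elim!: eventually_mono)
    show ?thesis using 1 by (simp add: DERIV_cong_ev[OF refl ev refl])
  next
    case 2
    then have ev: "\<forall>\<^sub>F z in nhds y. (max 0 z)\<^sup>2 = z\<^sup>2"
      using eventually_nhds_in_open[of "{0<..}" y] by (auto elim!: eventually_mono)
    have "((\<lambda>z. z\<^sup>2) has_real_derivative 2 * y) (at y)"
      by (auto intro!: derivative_eq_intros)
    with 2 show ?thesis by (simp add: DERIV_cong_ev[OF refl ev refl])
  next
    case 3
    have "((\<lambda>h::real. max 0 h) \<longlongrightarrow> max 0 0) (at 0)" by (intro tendsto_intros)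
    moreover have "((max 0 h)\<^sup>2 - (max 0 0)\<^sup>2) / (h - 0) = max 0 h" for h :: real
      by (auto simp: max_def power2_eq_square)
    ultimately show ?thesis using 3 by (simp add: has_field_derivative_iff)
  qed
qed

lemma DERIV_cutoff:
  assumes "e > 0"
  shows "(cutoff e has_real_derivative cutoff_deriv e r) (at r)"
proof (cases "r < e")
  case True
  then have ev: "\<forall>\<^sub>F s in nhds r. cutoff e s = 0"
    using eventually_nhds_in_open[of "{..<e}" r] assms by (auto elim!: eventually_mono simp: cutoff_eq_0)
  show ?thesis
    using True assms by (simp add: DERIV_cong_ev[OF refl ev refl] cutoff_deriv_eq_0)
next
  case False
  then have r: "r > 0" using assms by simp
  have pos: "cutoff e s = (max 0 (1 - e / s))\<^sup>2" if "s > 0" for s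
  proof (cases "s \<le> e")
    case True
    then have "1 - e / s \<le> 0" using that by simp
    then show ?thesis using True assms by (simp add: cutoff_eq_0)
  next
    case False
    then have "1 - e / s \<ge> 0" using that by simp
    then show ?thesis using False by (simp add: cutoff_def)
  qed
  have "((\<lambda>s. (max 0 (1 - e / s))\<^sup>2) has_real_derivative 2 * max 0 (1 - e / r) * (e / r\<^sup>2)) (at r)"
    by (rule DERIV_chain'[OF _ DERIV_max_0_square, THEN DERIV_cong])
       (use r in \<open>auto intro!: derivative_eq_intros simp: power2_eq_square\<close>)
  moreover have ev: "\<forall>\<^sub>F s in nhds r. cutoff e s = (max 0 (1 - e / s))\<^sup>2"
    using eventually_nhds_in_open[of "{0<..}" r] r pos by (auto elim!: eventually_mono)
  moreover have "2 * max 0 (1 - e / r) * (e / r\<^sup>2) = cutoff_deriv e r"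
  proof -
    have "1 - e / r \<ge> 0" using False r by simp
    then show ?thesis using False by (simp add: cutoff_deriv_def)
  qed
  ultimately show ?thesis
    by (simp add: DERIV_cong_ev[OF refl ev refl])
qed

lemma tendsto_cutoff:
  assumes "e \<longlonglongrightarrow> 0" and "r > 0"
  shows "(\<lambda>k. cutoff (e k) r) \<longlonglongrightarrow> 1" and "(\<lambda>k. cutoff_deriv (e k) r) \<longlonglongrightarrow> 0"
proof -
  have m: "(\<lambda>k. max (e k) r) \<longlonglongrightarrow> r"
    using tendsto_max[OF assms(1) tendsto_const[of r]] assms(2) by simp
  have "(\<lambda>k. (1 - e k / max (e k) r)\<^sup>2) \<longlonglongrightarrow> (1 - 0 / r)\<^sup>2"
    by (intro tendsto_intros assms m) (use assms in auto)
  then show "(\<lambda>k. cutoff (e k) r) \<longlonglongrightarrow> 1" by (simp add: cutoff_def)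
  have "(\<lambda>k. 2 * (1 - e k / max (e k) r) * (e k / (max (e k) r)\<^sup>2)) \<longlonglongrightarrow> 2 * (1 - 0 / r) * (0 / r\<^sup>2)"
    by (intro tendsto_intros assms m) (use assms in auto)
  then show "(\<lambda>k. cutoff_deriv (e k) r) \<longlonglongrightarrow> 0" by (simp add: cutoff_deriv_def)
qed

text \<open>A form of Fatou's lemma.\<close>

lemma integrable_limit_bounded_integral:
  fixes f :: "nat \<Rightarrow> 'a \<Rightarrow> real"
  assumes int: "\<And>k. integrable M (f k)" and nn: "\<And>k x. 0 \<le> f k x"
    and lim: "\<And>x. (\<lambda>k. f k x) \<longlonglongrightarrow> F x" and C: "\<And>k. (\<integral>x. f k x \<partial>M) \<le> C"
  shows "integrable M F"
proof (rule integrableI_bounded)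
  have [measurable]: "f k \<in> borel_measurable M" for k using int by simp
  show "F \<in> borel_measurable M" by (rule borel_measurable_LIMSEQ_real[OF lim]) simp
  have "0 \<le> F x" for x by (rule LIMSEQ_le_const[OF lim]) (use nn in auto)
  then have "(\<integral>\<^sup>+ x. ennreal (norm (F x)) \<partial>M) = (\<integral>\<^sup>+ x. liminf (\<lambda>k. ennreal (f k x)) \<partial>M)"
    using lim_imp_Liminf[OF sequentially_bot tendsto_ennrealI[OF lim]] by (intro nn_integral_cong) simp
  also have "\<dots> \<le> liminf (\<lambda>k. \<integral>\<^sup>+ x. ennreal (f k x) \<partial>M)"
    by (rule nn_integral_liminf) simp
  also have "\<dots> \<le> ennreal C"
  proof (rule Liminf_le)
    show "\<forall>\<^sub>F k in sequentially. (\<integral>\<^sup>+ x. ennreal (f k x) \<partial>M) \<le> ennreal C"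
      using int nn C by (intro always_eventually allI) (simp add: nn_integral_eq_integral ennreal_leI)
  qed simp
  finally show "(\<integral>\<^sup>+ x. ennreal (norm (F x)) \<partial>M) < \<infinity>"
    by (simp add: le_less_trans ennreal_less_top)
qed

lemma differentiable_has_partial:
  assumes "\<And>x. x \<in> S \<Longrightarrow> f differentiable (at x)"
  shows "has_partial_on S i f (partial_deriv i f)"
  unfolding has_partial_on_def
proof
  fix x assume "x \<in> S"
  then have "(f has_derivative frechet_derivative f (at x)) (at (x + 0 *\<^sub>R axis i 1))"
    using assms by (simp add: frechet_derivative_works[symmetric])
  moreover have "((\<lambda>t. x + t *\<^sub>R axis i 1) has_derivative (\<lambda>t. t *\<^sub>R axis i (1::real))) (at 0)"
    by (auto intro!: derivative_eq_intros)
  ultimately have "((\<lambda>t. f (x + t *\<^sub>R axis i 1)) has_derivative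
      (\<lambda>t. frechet_derivative f (at x) (t *\<^sub>R axis i 1))) (at 0)"
    by (rule has_derivative_compose[rotated])
  moreover have "linear (frechet_derivative f (at x))"
    using assms \<open>x \<in> S\<close> by (intro linear_frechet_derivative) auto
  ultimately show "((\<lambda>t. f (x + t *\<^sub>R axis i 1)) has_real_derivative partial_deriv i f x) (at 0)"
    unfolding has_field_derivative_def partial_deriv_def
    by (elim has_derivative_eq_rhs) (simp add: fun_eq_iff linear_cmul mult.commute)
qed

section \<open>Truncation of two eigenfunctions\<close>

lemma set_integrable_continuous_closure:
  fixes h :: "real^'n::finite \<Rightarrow> real"
  assumes "open S" and "bounded S" and "continuous_on (closure S) h"
  shows "set_integrable lborel S h"
proof (rule set_integrable_subset)
  show "set_integrable lborel (closure S) h"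
    using assms(2,3) by (intro set_integrable_continuous_compact) auto
qed (use assms(1) closure_subset[of S] in auto)

text \<open>Two classical eigenfunctions \<open>u\<close>, \<open>v\<close> with distinct eigenvalues, for a potential bounded below
  by \<open>m\<close>. Nothing is assumed about their behaviour near the boundary beyond continuity, nor is the
  potential bounded above, so square integrability of the gradients has to be proved.\<close>

locale dirichlet_pair =
  fixes \<Omega> :: "(real^'n::finite) set" and q :: "real^'n \<Rightarrow> real" and lam mu m :: real
    and u v :: "real^'n \<Rightarrow> real"
  assumes open_domain: "open \<Omega>" and bounded_domain: "bounded \<Omega>"
    and eigenfunction_u: "dirichlet_eigenfunction \<Omega> q lam u"
    and eigenfunction_v: "dirichlet_eigenfunction \<Omega> q mu v"
    and potential_ge: "\<And>x. x \<in> \<Omega> \<Longrightarrow> m \<le> q x"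
    and eigenvalue_less: "lam < mu"
begin

abbreviation "du i \<equiv> partial_deriv i u"
abbreviation "dv i \<equiv> partial_deriv i v"
abbreviation "ddu i \<equiv> partial_deriv i (partial_deriv i u)"
abbreviation "ddv i \<equiv> partial_deriv i (partial_deriv i v)"

text \<open>Both functions are truncated by a cutoff of the common quantity \<open>\<rho> = u\<^sup>2 + v\<^sup>2\<close>. Truncating each
  of them separately would leave gradients on the zero set of one function uncontrolled.\<close>

definition \<rho> :: "real^'n \<Rightarrow> real" where "\<rho> x = (u x)\<^sup>2 + (v x)\<^sup>2"

text \<open>The partial derivatives of \<^const>\<open>\<rho>\<close>.\<close>

definition d\<rho> :: "'n \<Rightarrow> real^'n \<Rightarrow> real" where "d\<rho> i x = 2 * (u x * du i x + v x * dv i x)"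

text \<open>The energy density \<open>\<bar>\<nabla>u\<bar>\<^sup>2 + \<bar>\<nabla>v\<bar>\<^sup>2\<close>.\<close>

definition energy :: "real^'n \<Rightarrow> real" where "energy x = (\<Sum>i\<in>UNIV. (du i x)\<^sup>2 + (dv i x)\<^sup>2)"

lemma
  shows continuous_closure_u: "continuous_on (closure \<Omega>) u"
    and continuous_closure_v: "continuous_on (closure \<Omega>) v"
  using eigenfunction_u eigenfunction_v by (auto simp: dirichlet_eigenfunction_def)

lemma
  shows continuous_u [continuous_intros]: "continuous_on \<Omega> u"
    and continuous_v [continuous_intros]: "continuous_on \<Omega> v"
  using continuous_closure_u continuous_closure_v closure_subset
  by (auto intro: continuous_on_subset)

lemma
  shows partial_u: "has_partial_on \<Omega> i u (du i)" and partial_du: "has_partial_on \<Omega> i (du i) (ddu i)"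
    and partial_v: "has_partial_on \<Omega> i v (dv i)" and partial_dv: "has_partial_on \<Omega> i (dv i) (ddv i)"
  using eigenfunction_u eigenfunction_v
  by (auto simp: dirichlet_eigenfunction_def C2_on_def intro!: differentiable_has_partial)

lemma
  shows continuous_du [continuous_intros]: "continuous_on \<Omega> (du i)"
    and continuous_dv [continuous_intros]: "continuous_on \<Omega> (dv i)"
    and continuous_ddu [continuous_intros]: "continuous_on \<Omega> (ddu i)"
    and continuous_ddv [continuous_intros]: "continuous_on \<Omega> (ddv i)"
  using eigenfunction_u eigenfunction_v
  by (auto simp: dirichlet_eigenfunction_def C2_on_def
      intro!: continuous_at_imp_continuous_on differentiable_imp_continuous_within)

lemma
  assumes "x \<in> \<Omega>"
  shows laplacian_u: "(\<Sum>i\<in>UNIV. ddu i x) = (q x - lam) * u x"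
    and laplacian_v: "(\<Sum>i\<in>UNIV. ddv i x) = (q x - mu) * v x"
  using eigenfunction_u eigenfunction_v assms
  by (auto simp: dirichlet_eigenfunction_def laplacian_def algebra_simps)

lemma continuous_\<rho> [continuous_intros]: "continuous_on \<Omega> \<rho>"
  unfolding \<rho>_def[abs_def] by (intro continuous_intros)

lemma continuous_closure_\<rho>: "continuous_on (closure \<Omega>) \<rho>"
  unfolding \<rho>_def[abs_def] by (intro continuous_intros continuous_closure_u continuous_closure_v)

lemma continuous_d\<rho> [continuous_intros]: "continuous_on \<Omega> (d\<rho> i)"
  unfolding d\<rho>_def[abs_def] by (intro continuous_intros)

lemma continuous_energy [continuous_intros]: "continuous_on \<Omega> energy"
  unfolding energy_def[abs_def] by (intro continuous_intros)

lemma partial_\<rho>: "has_partial_on \<Omega> i \<rho> (d\<rho> i)"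
  using has_partial_on_add[OF has_partial_on_mult[OF partial_u[of i] partial_u] has_partial_on_mult[OF partial_v partial_v]]
  by (simp add: \<rho>_def[abs_def] d\<rho>_def[abs_def] power2_eq_square algebra_simps)

lemma \<rho>_nonneg: "0 \<le> \<rho> x" by (simp add: \<rho>_def)

lemma energy_nonneg: "0 \<le> energy x" by (auto simp: energy_def intro!: sum_nonneg)

text \<open>The compact set where \<open>\<rho> \<ge> e\<close>. For \<open>e > 0\<close> it lies in the open domain because \<open>\<rho>\<close> vanishes on the
  boundary; truncation at level \<open>e\<close> gives functions supported in it.\<close>

definition core :: "real \<Rightarrow> (real^'n) set" where "core e = {x \<in> closure \<Omega>. e \<le> \<rho> x}"

lemma compact_core: "compact (core e)"
proof -
  have "core e = closure \<Omega> \<inter> \<rho> -` {e..}" by (auto simp: core_def)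
  moreover have "closed (closure \<Omega> \<inter> \<rho> -` {e..})"
    by (intro continuous_closed_preimage continuous_closure_\<rho>) auto
  moreover have "bounded (core e)"
    by (rule bounded_subset[OF bounded_closure[OF bounded_domain]]) (auto simp: core_def)
  ultimately show ?thesis by (simp add: compact_eq_bounded_closed)
qed

lemma core_subset: "e > 0 \<Longrightarrow> core e \<subseteq> \<Omega>"
  using eigenfunction_u eigenfunction_v closure_Un_frontier[of \<Omega>]
  by (fastforce simp: core_def dirichlet_eigenfunction_def \<rho>_def)

text \<open>The divergence theorem for the vector field \<open>c(\<rho>) h\<close>.\<close>

lemma integral_cutoff_partial_sum:
  assumes "e > 0" and c0: "\<And>r. r \<le> e \<Longrightarrow> c r = 0"
    and c': "\<And>r. (c has_real_derivative c' r) (at r)" and cont_c': "continuous_on UNIV c'"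
    and h: "\<And>i. has_partial_on \<Omega> i (h i) (h' i)" "\<And>i. continuous_on \<Omega> (h i)"
      "\<And>i. continuous_on \<Omega> (h' i)"
  shows "set_integrable lborel \<Omega> (\<lambda>x. \<Sum>i\<in>UNIV. c' (\<rho> x) * d\<rho> i x * h i x + c (\<rho> x) * h' i x)"
    and "(LINT x:\<Omega>|lborel. (\<Sum>i\<in>UNIV. c' (\<rho> x) * d\<rho> i x * h i x + c (\<rho> x) * h' i x)) = 0"
proof -
  define g where "g i x = c' (\<rho> x) * d\<rho> i x * h i x + c (\<rho> x) * h' i x" for i x
  have cc: "continuous_on UNIV c"
    using c' by (auto intro!: continuous_at_imp_continuous_on DERIV_isCont)
  have cr: "continuous_on \<Omega> (\<lambda>x. c (\<rho> x))" "continuous_on \<Omega> (\<lambda>x. c' (\<rho> x))"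
    using continuous_on_compose2[OF cc continuous_\<rho>] continuous_on_compose2[OF cont_c' continuous_\<rho>]
    by auto
  have p: "has_partial_on \<Omega> i (\<lambda>x. c (\<rho> x) * h i x) (g i)" for i
    using has_partial_on_mult[OF has_partial_on_compose[OF partial_\<rho> c'] h(1)[of i]]
    by (simp add: g_def[abs_def])
  have z: "c (\<rho> x) * h i x = 0" if "x \<in> \<Omega> - core e" for x i
  proof -
    have "x \<in> closure \<Omega>" using that closure_subset by auto
    with that have "\<rho> x \<le> e" by (auto simp: core_def)
    then show ?thesis by (simp add: c0)
  qed
  have gi: "set_integrable lborel \<Omega> (g i)" "(LINT x:\<Omega>|lborel. g i x) = 0" for i
  proof -
    have "continuous_on \<Omega> (\<lambda>x. c (\<rho> x) * h i x)" "continuous_on \<Omega> (g i)"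
      unfolding g_def[abs_def] by (intro continuous_intros cr h)+
    from integral_partial_eq_0[OF open_domain compact_core core_subset[OF assms(1)] this p z]
    show "set_integrable lborel \<Omega> (g i)" "(LINT x:\<Omega>|lborel. g i x) = 0" by auto
  qed
  show "set_integrable lborel \<Omega> (\<lambda>x. \<Sum>i\<in>UNIV. c' (\<rho> x) * d\<rho> i x * h i x + c (\<rho> x) * h' i x)"
    using gi(1) unfolding g_def[symmetric] set_integrable_def scaleR_sum_right
    by (intro Bochner_Integration.integrable_sum)
  show "(LINT x:\<Omega>|lborel. (\<Sum>i\<in>UNIV. c' (\<rho> x) * d\<rho> i x * h i x + c (\<rho> x) * h' i x)) = 0"
    using gi unfolding g_def[symmetric] set_integrable_def set_lebesgue_integral_def scaleR_sum_right
    by (subst Bochner_Integration.integral_sum) auto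
qed

lemma set_integrable_cutoff:
  fixes h :: "real^'n \<Rightarrow> real"
  assumes "e > 0" and "\<And>r. r \<le> e \<Longrightarrow> c r = 0" and "continuous_on UNIV c" and "continuous_on \<Omega> h"
  shows "set_integrable lborel \<Omega> (\<lambda>x. c (\<rho> x) * h x)"
proof (rule set_integrable_continuous_compact_support[OF _ compact_core core_subset[OF assms(1)]])
  show "continuous_on \<Omega> (\<lambda>x. c (\<rho> x) * h x)"
    using continuous_on_compose2[OF assms(3) continuous_\<rho>] assms(4) by (auto intro!: continuous_intros)
  fix x assume x: "x \<in> \<Omega> - core e"
  then have "x \<in> closure \<Omega>" using closure_subset by auto
  with x have "\<rho> x \<le> e" by (auto simp: core_def)
  then show "c (\<rho> x) * h x = 0" by (simp add: assms(2))
qed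

lemma set_integrable_\<rho>: "set_integrable lborel \<Omega> \<rho>"
  by (rule set_integrable_continuous_closure[OF open_domain bounded_domain continuous_closure_\<rho>])

text \<open>Divergence theorem for \<open>c(\<rho>) (u \<nabla>u + v \<nabla>v)\<close>. The term in which the cutoff is differentiated
  is \<open>2 c'(\<rho>) \<bar>u \<nabla>u + v \<nabla>v\<bar>\<^sup>2 \<ge> 0\<close> and can be dropped; the bound does not depend on \<open>e\<close>.\<close>

lemma integral_cutoff_energy_le:
  assumes "e > 0"
  shows "(LINT x:\<Omega>|lborel. cutoff e (\<rho> x) * energy x) \<le> \<bar>mu - m\<bar> * (LINT x:\<Omega>|lborel. \<rho> x)"
proof -
  define h where "h i x = u x * du i x + v x * dv i x" for i x
  define h' where "h' i x = (du i x * du i x + u x * ddu i x) + (dv i x * dv i x + v x * ddv i x)" for i x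
  define T where "T x = (\<Sum>i\<in>UNIV. cutoff_deriv e (\<rho> x) * d\<rho> i x * h i x + cutoff e (\<rho> x) * h' i x)" for x
  have hp: "has_partial_on \<Omega> i (h i) (h' i)" for i
    unfolding h_def[abs_def] h'_def[abs_def]
    by (intro has_partial_on_add has_partial_on_mult partial_u partial_v partial_du partial_dv)
  have hc: "continuous_on \<Omega> (h i)" "continuous_on \<Omega> (h' i)" for i
    unfolding h_def[abs_def] h'_def[abs_def] by (intro continuous_intros)+
  have T: "set_integrable lborel \<Omega> T" "(LINT x:\<Omega>|lborel. T x) = 0"
    unfolding T_def[abs_def]
    by (rule integral_cutoff_partial_sum[OF assms cutoff_eq_0[OF assms] DERIV_cutoff[OF assms]
          continuous_on_cutoff_deriv[OF assms] hp hc]; assumption)+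
  have le: "cutoff e (\<rho> x) * energy x \<le> T x + \<bar>mu - m\<bar> * \<rho> x" if x: "x \<in> \<Omega>" for x
  proof -
    have "(\<Sum>i\<in>UNIV. h' i x) = energy x + u x * (\<Sum>i\<in>UNIV. ddu i x) + v x * (\<Sum>i\<in>UNIV. ddv i x)"
      by (simp add: h'_def energy_def sum.distrib sum_distrib_left power2_eq_square)
    then have sh: "(\<Sum>i\<in>UNIV. h' i x) = energy x + ((q x - lam) * (u x)\<^sup>2 + (q x - mu) * (v x)\<^sup>2)"
      by (simp add: laplacian_u[OF x] laplacian_v[OF x] power2_eq_square)
    have "0 \<le> cutoff_deriv e (\<rho> x) * (2 * (\<Sum>i\<in>UNIV. (h i x)\<^sup>2))"
      using cutoff_deriv_bounds(1)[OF assms \<rho>_nonneg] by (intro mult_nonneg_nonneg) (auto intro!: sum_nonneg)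
    also have "\<dots> = (\<Sum>i\<in>UNIV. cutoff_deriv e (\<rho> x) * d\<rho> i x * h i x)"
      unfolding sum_distrib_left
      by (rule sum.cong[OF refl]) (simp add: d\<rho>_def h_def power2_eq_square)
    finally have "cutoff e (\<rho> x) * (\<Sum>i\<in>UNIV. h' i x) \<le> T x"
      by (simp add: T_def sum.distrib sum_distrib_left)
    moreover have "- ((q x - lam) * (u x)\<^sup>2 + (q x - mu) * (v x)\<^sup>2) \<le> \<bar>mu - m\<bar> * \<rho> x"
    proof -
      have "(lam - q x) * (u x)\<^sup>2 \<le> \<bar>mu - m\<bar> * (u x)\<^sup>2" "(mu - q x) * (v x)\<^sup>2 \<le> \<bar>mu - m\<bar> * (v x)\<^sup>2"
        using potential_ge[OF x] eigenvalue_less by (intro mult_right_mono; simp)+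
      then show ?thesis by (simp add: \<rho>_def algebra_simps)
    qed
    then have "cutoff e (\<rho> x) * - ((q x - lam) * (u x)\<^sup>2 + (q x - mu) * (v x)\<^sup>2) \<le> 1 * (\<bar>mu - m\<bar> * \<rho> x)"
      using cutoff_bounds[OF assms, of "\<rho> x"] \<rho>_nonneg[of x]
      by (intro order_trans[OF mult_left_mono mult_right_mono]) auto
    ultimately show ?thesis by (simp add: sh algebra_simps)
  qed
  have "(LINT x:\<Omega>|lborel. cutoff e (\<rho> x) * energy x) \<le> (LINT x:\<Omega>|lborel. T x + \<bar>mu - m\<bar> * \<rho> x)"
  proof (rule set_integral_mono)
    show "set_integrable lborel \<Omega> (\<lambda>x. cutoff e (\<rho> x) * energy x)"
      by (rule set_integrable_cutoff[OF assms cutoff_eq_0[OF assms] continuous_on_cutoff[OF assms] continuous_energy])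
    show "set_integrable lborel \<Omega> (\<lambda>x. T x + \<bar>mu - m\<bar> * \<rho> x)"
      by (intro set_integral_add(1) T set_integrable_mult_right set_integrable_\<rho>)
  qed (rule le)
  also have "\<dots> = \<bar>mu - m\<bar> * (LINT x:\<Omega>|lborel. \<rho> x)"
    using T set_integrable_\<rho> by (subst set_integral_add(2)) auto
  finally show ?thesis .
qed

text \<open>A sequence of truncation levels tending to zero.\<close>

definition \<epsilon> :: "nat \<Rightarrow> real" where "\<epsilon> k = inverse (real (Suc k))"

lemma \<epsilon>_pos: "\<epsilon> k > 0" by (simp add: \<epsilon>_def)

lemma \<epsilon>_lim: "\<epsilon> \<longlonglongrightarrow> 0" unfolding \<epsilon>_def[abs_def] by (rule LIMSEQ_inverse_real_of_nat)

text \<open>Up to a constant factor, this integral dominates every error term caused by differentiating the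
  cutoff.\<close>

definition cutoff_error :: "nat \<Rightarrow> real" where
  "cutoff_error k = (LINT x:\<Omega>|lborel. \<rho> x * cutoff_deriv (\<epsilon> k) (\<rho> x) * energy x)"

lemma set_integrable_cutoff_error:
  "set_integrable lborel \<Omega> (\<lambda>x. \<rho> x * cutoff_deriv (\<epsilon> k) (\<rho> x) * energy x)"
proof (rule set_integrable_cutoff[OF \<epsilon>_pos[of k], where c="\<lambda>r. r * cutoff_deriv (\<epsilon> k) r"])
  show "continuous_on UNIV (\<lambda>r. r * cutoff_deriv (\<epsilon> k) r)"
    by (intro continuous_on_mult continuous_on_id continuous_on_cutoff_deriv \<epsilon>_pos)
qed (auto simp: cutoff_deriv_eq_0[OF \<epsilon>_pos] continuous_energy)

text \<open>The restriction to \<open>\<rho> > 0\<close> is all that the truncations see, and it avoids showing that the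
  gradients vanish almost everywhere on the common zero set.\<close>

lemma set_integrable_energy: "set_integrable lborel \<Omega> (\<lambda>x. if \<rho> x > 0 then energy x else 0)"
  unfolding set_integrable_def
proof (rule integrable_limit_bounded_integral)
  fix k x
  show "integrable lborel (\<lambda>x. indicator \<Omega> x *\<^sub>R (cutoff (\<epsilon> k) (\<rho> x) * energy x))"
    using set_integrable_cutoff[OF \<epsilon>_pos cutoff_eq_0[OF \<epsilon>_pos] continuous_on_cutoff[OF \<epsilon>_pos] continuous_energy]
    by (simp add: set_integrable_def)
  show "0 \<le> indicator \<Omega> x *\<^sub>R (cutoff (\<epsilon> k) (\<rho> x) * energy x)"
    using cutoff_bounds[OF \<epsilon>_pos] energy_nonneg by auto
  show "(\<integral>x. indicator \<Omega> x *\<^sub>R (cutoff (\<epsilon> k) (\<rho> x) * energy x) \<partial>lborel)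
      \<le> \<bar>mu - m\<bar> * (LINT x:\<Omega>|lborel. \<rho> x)"
    using integral_cutoff_energy_le[OF \<epsilon>_pos, of k] by (simp add: set_lebesgue_integral_def)
next
  fix x
  show "(\<lambda>k. indicator \<Omega> x *\<^sub>R (cutoff (\<epsilon> k) (\<rho> x) * energy x))
      \<longlonglongrightarrow> indicator \<Omega> x *\<^sub>R (if \<rho> x > 0 then energy x else 0)"
  proof (cases "\<rho> x > 0")
    case True
    have "(\<lambda>k. indicator \<Omega> x *\<^sub>R (cutoff (\<epsilon> k) (\<rho> x) * energy x)) \<longlonglongrightarrow> indicator \<Omega> x *\<^sub>R (1 * energy x)"
      by (intro tendsto_intros tendsto_cutoff(1)[OF \<epsilon>_lim True])
    with True show ?thesis by simp
  next
    case False
    then have "\<rho> x \<le> \<epsilon> k" for k using \<epsilon>_pos[of k] by linarith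
    then show ?thesis using False by (simp add: cutoff_eq_0[OF \<epsilon>_pos])
  qed
qed

lemma cutoff_error_tendsto_0: "cutoff_error \<longlonglongrightarrow> 0"
proof -
  have "cutoff_error \<longlonglongrightarrow> (\<integral>x. 0 \<partial>(lborel :: (real^'n) measure))"
    unfolding cutoff_error_def[abs_def] set_lebesgue_integral_def
  proof (rule integral_dominated_convergence)
    show "integrable lborel (\<lambda>x. indicator \<Omega> x *\<^sub>R (if \<rho> x > 0 then energy x else 0))"
      using set_integrable_energy by (simp add: set_integrable_def)
    show "(\<lambda>x. indicator \<Omega> x *\<^sub>R (\<rho> x * cutoff_deriv (\<epsilon> k) (\<rho> x) * energy x)) \<in> borel_measurable lborel" for k
      using set_integrable_cutoff_error[of k] by (auto simp: set_integrable_def)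
    show "AE x in lborel. (\<lambda>k. indicator \<Omega> x *\<^sub>R (\<rho> x * cutoff_deriv (\<epsilon> k) (\<rho> x) * energy x)) \<longlonglongrightarrow> 0"
    proof (rule AE_I2)
      fix x
      show "(\<lambda>k. indicator \<Omega> x *\<^sub>R (\<rho> x * cutoff_deriv (\<epsilon> k) (\<rho> x) * energy x)) \<longlonglongrightarrow> 0"
      proof (cases "\<rho> x > 0")
        case True
        have "(\<lambda>k. indicator \<Omega> x *\<^sub>R (\<rho> x * cutoff_deriv (\<epsilon> k) (\<rho> x) * energy x))
            \<longlonglongrightarrow> indicator \<Omega> x *\<^sub>R (\<rho> x * 0 * energy x)"
          by (intro tendsto_intros tendsto_cutoff(2)[OF \<epsilon>_lim True])
        then show ?thesis by simp
      next
        case False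
        then have "\<rho> x = 0" using \<rho>_nonneg[of x] by linarith
        then show ?thesis by simp
      qed
    qed
    show "AE x in lborel. norm (indicator \<Omega> x *\<^sub>R (\<rho> x * cutoff_deriv (\<epsilon> k) (\<rho> x) * energy x))
        \<le> indicator \<Omega> x *\<^sub>R (if \<rho> x > 0 then energy x else 0)" for k
    proof (rule AE_I2)
      fix x
      have "0 \<le> \<rho> x * cutoff_deriv (\<epsilon> k) (\<rho> x)" "\<rho> x * cutoff_deriv (\<epsilon> k) (\<rho> x) \<le> 1"
        using cutoff_deriv_bounds[OF \<epsilon>_pos[of k] \<rho>_nonneg[of x]] \<rho>_nonneg[of x] by auto
      then have "\<bar>\<rho> x * cutoff_deriv (\<epsilon> k) (\<rho> x) * energy x\<bar> \<le> energy x"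
        using energy_nonneg[of x] mult_right_mono[of _ 1 "energy x"] by (simp add: abs_mult)
      moreover have "\<rho> x = 0" if "\<not> \<rho> x > 0" using that \<rho>_nonneg[of x] by linarith
      ultimately show "norm (indicator \<Omega> x *\<^sub>R (\<rho> x * cutoff_deriv (\<epsilon> k) (\<rho> x) * energy x))
          \<le> indicator \<Omega> x *\<^sub>R (if \<rho> x > 0 then energy x else 0)"
        by (auto simp: indicator_def)
    qed
  qed simp
  then show ?thesis by simp
qed

lemma integral_cutoff_power_tendsto:
  assumes "continuous_on (closure \<Omega>) h" and "\<And>x. x \<in> \<Omega> \<Longrightarrow> \<rho> x = 0 \<Longrightarrow> h x = 0"
  shows "(\<lambda>k. LINT x:\<Omega>|lborel. (cutoff (\<epsilon> k) (\<rho> x)) ^ p * h x) \<longlonglongrightarrow> (LINT x:\<Omega>|lborel. h x)"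
  unfolding set_lebesgue_integral_def
proof (rule integral_dominated_convergence)
  have int: "set_integrable lborel \<Omega> h"
    by (rule set_integrable_continuous_closure[OF open_domain bounded_domain assms(1)])
  then show "integrable lborel (\<lambda>x. \<bar>indicator \<Omega> x *\<^sub>R h x\<bar>)"
    by (simp add: set_integrable_def)
  show "(\<lambda>x. indicator \<Omega> x *\<^sub>R h x) \<in> borel_measurable lborel"
    using int by (auto simp: set_integrable_def)
  show "(\<lambda>x. indicator \<Omega> x *\<^sub>R ((cutoff (\<epsilon> k) (\<rho> x)) ^ p * h x)) \<in> borel_measurable lborel" for k
  proof -
    have "continuous_on \<Omega> (\<lambda>x. (cutoff (\<epsilon> k) (\<rho> x)) ^ p * h x)"
      using assms(1) closure_subset[of \<Omega>]
      by (intro continuous_intros continuous_on_compose2[OF continuous_on_cutoff[OF \<epsilon>_pos] continuous_\<rho>])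
         (auto intro: continuous_on_subset)
    then have "(\<lambda>x. indicator \<Omega> x *\<^sub>R ((cutoff (\<epsilon> k) (\<rho> x)) ^ p * h x)) \<in> borel_measurable borel"
      by (intro borel_measurable_continuous_on_indicator) (use open_domain in auto)
    then show ?thesis by simp
  qed
  show "AE x in lborel. (\<lambda>k. indicator \<Omega> x *\<^sub>R ((cutoff (\<epsilon> k) (\<rho> x)) ^ p * h x)) \<longlonglongrightarrow> indicator \<Omega> x *\<^sub>R h x"
  proof (rule AE_I2)
    fix x
    show "(\<lambda>k. indicator \<Omega> x *\<^sub>R ((cutoff (\<epsilon> k) (\<rho> x)) ^ p * h x)) \<longlonglongrightarrow> indicator \<Omega> x *\<^sub>R h x"
    proof (cases "\<rho> x > 0")
      case True
      have "(\<lambda>k. indicator \<Omega> x *\<^sub>R ((cutoff (\<epsilon> k) (\<rho> x)) ^ p * h x)) \<longlonglongrightarrow> indicator \<Omega> x *\<^sub>R (1 ^ p * h x)"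
        by (intro tendsto_intros tendsto_cutoff(1)[OF \<epsilon>_lim True])
      then show ?thesis by simp
    next
      case False
      then have "\<rho> x = 0" using \<rho>_nonneg[of x] by linarith
      then show ?thesis using assms(2)[of x] by (cases "x \<in> \<Omega>") auto
    qed
  qed
  show "AE x in lborel. norm (indicator \<Omega> x *\<^sub>R ((cutoff (\<epsilon> k) (\<rho> x)) ^ p * h x)) \<le> \<bar>indicator \<Omega> x *\<^sub>R h x\<bar>" for k
  proof (rule AE_I2)
    fix x
    have "\<bar>(cutoff (\<epsilon> k) (\<rho> x)) ^ p\<bar> \<le> 1"
      using cutoff_bounds[OF \<epsilon>_pos, of k "\<rho> x"] by (simp add: power_abs power_le_one)
    then show "norm (indicator \<Omega> x *\<^sub>R ((cutoff (\<epsilon> k) (\<rho> x)) ^ p * h x)) \<le> \<bar>indicator \<Omega> x *\<^sub>R h x\<bar>"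
      using mult_right_mono[of _ 1 "\<bar>h x\<bar>"] by (auto simp: indicator_def abs_mult)
  qed
qed

section \<open>Orthogonality and energy of combinations of two eigenfunctions\<close>

lemma set_integrable_closure:
  "continuous_on (closure \<Omega>) h \<Longrightarrow> set_integrable lborel \<Omega> (h :: real^'n \<Rightarrow> real)"
  by (rule set_integrable_continuous_closure[OF open_domain bounded_domain])

text \<open>Divergence theorem for \<open>c(\<rho>) (u \<nabla>v - v \<nabla>u)\<close>, whose divergence without the cutoff is
  \<open>(lam - mu) u v\<close>; the possibly unbounded potential cancels.\<close>

lemma eigenfunctions_orthogonal: "(LINT x:\<Omega>|lborel. u x * v x) = 0"
proof -
  define h where "h i x = u x * dv i x + (- 1) * (v x * du i x)" for i x
  define h' where "h' i x = (du i x * dv i x + u x * ddv i x)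
    + (0 * (v x * du i x) + (- 1) * (dv i x * du i x + v x * ddu i x))" for i x
  have hp: "has_partial_on \<Omega> i (h i) (h' i)" for i
    unfolding h_def[abs_def] h'_def[abs_def]
    by (intro has_partial_on_add has_partial_on_mult has_partial_on_const partial_u partial_v partial_du partial_dv)
  have hc: "continuous_on \<Omega> (h i)" "continuous_on \<Omega> (h' i)" for i
    unfolding h_def[abs_def] h'_def[abs_def] by (intro continuous_intros)+
  define T where "T k x = (\<Sum>i\<in>UNIV. cutoff_deriv (\<epsilon> k) (\<rho> x) * d\<rho> i x * h i x + cutoff (\<epsilon> k) (\<rho> x) * h' i x)" for k x
  define X where "X k = (LINT x:\<Omega>|lborel. cutoff (\<epsilon> k) (\<rho> x) * (u x * v x))" for k
  have T: "set_integrable lborel \<Omega> (T k)" "(LINT x:\<Omega>|lborel. T k x) = 0" for k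
    unfolding T_def[abs_def]
    by (rule integral_cutoff_partial_sum[OF \<epsilon>_pos cutoff_eq_0[OF \<epsilon>_pos] DERIV_cutoff[OF \<epsilon>_pos]
          continuous_on_cutoff_deriv[OF \<epsilon>_pos] hp hc]; assumption)+
  have pointwise: "\<bar>T k x + (mu - lam) * (cutoff (\<epsilon> k) (\<rho> x) * (u x * v x))\<bar>
      \<le> \<rho> x * cutoff_deriv (\<epsilon> k) (\<rho> x) * energy x" if x: "x \<in> \<Omega>" for k x
  proof -
    have "(\<Sum>i\<in>UNIV. h' i x) = u x * (\<Sum>i\<in>UNIV. ddv i x) - v x * (\<Sum>i\<in>UNIV. ddu i x)"
      by (simp add: h'_def sum.distrib sum_subtractf sum_distrib_left sum_negf algebra_simps)
    also have "\<dots> = (lam - mu) * (u x * v x)"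
      unfolding laplacian_u[OF x] laplacian_v[OF x] by (simp add: algebra_simps)
    finally have sh: "(\<Sum>i\<in>UNIV. h' i x) = (lam - mu) * (u x * v x)" .
    have "T k x = cutoff_deriv (\<epsilon> k) (\<rho> x) * (\<Sum>i\<in>UNIV. d\<rho> i x * h i x)
        + cutoff (\<epsilon> k) (\<rho> x) * (\<Sum>i\<in>UNIV. h' i x)"
      by (simp add: T_def sum.distrib sum_distrib_left mult.assoc)
    then have "T k x + (mu - lam) * (cutoff (\<epsilon> k) (\<rho> x) * (u x * v x))
        = cutoff_deriv (\<epsilon> k) (\<rho> x) * (\<Sum>i\<in>UNIV. d\<rho> i x * h i x)"
      unfolding sh by (simp add: algebra_simps)
    moreover have "\<bar>\<Sum>i\<in>UNIV. d\<rho> i x * h i x\<bar> \<le> \<rho> x * energy x"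
    proof -
      have "\<bar>d\<rho> i x * h i x\<bar> \<le> \<rho> x * ((du i x)\<^sup>2 + (dv i x)\<^sup>2)" for i
      proof -
        let ?s = "u x * du i x + v x * dv i x"
        have "\<bar>2 * ?s * h i x\<bar> \<le> ?s\<^sup>2 + (h i x)\<^sup>2"
          using sum_squares_bound[of ?s "h i x"] sum_squares_bound[of ?s "- h i x"] by (auto simp: abs_if)
        \<comment> \<open>Lagrange's identity for the vectors \<open>(u, v)\<close> and \<open>(\<partial>\<^sub>i u, \<partial>\<^sub>i v)\<close>\<close>
        also have "\<dots> = \<rho> x * ((du i x)\<^sup>2 + (dv i x)\<^sup>2)"
          by (simp add: h_def \<rho>_def power2_eq_square algebra_simps)
        finally show ?thesis by (simp add: d\<rho>_def)
      qed
      then have "(\<Sum>i\<in>UNIV. \<bar>d\<rho> i x * h i x\<bar>) \<le> \<rho> x * energy x"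
        unfolding energy_def sum_distrib_left by (rule sum_mono)
      then show ?thesis by (rule order_trans[OF sum_abs])
    qed
    then have "cutoff_deriv (\<epsilon> k) (\<rho> x) * \<bar>\<Sum>i\<in>UNIV. d\<rho> i x * h i x\<bar>
        \<le> cutoff_deriv (\<epsilon> k) (\<rho> x) * (\<rho> x * energy x)"
      by (rule mult_left_mono) (rule cutoff_deriv_bounds(1)[OF \<epsilon>_pos \<rho>_nonneg])
    ultimately show ?thesis
      using cutoff_deriv_bounds(1)[OF \<epsilon>_pos \<rho>_nonneg, of k x] by (simp add: abs_mult mult_ac)
  qed
  have iX: "set_integrable lborel \<Omega> (\<lambda>x. (mu - lam) * (cutoff (\<epsilon> k) (\<rho> x) * (u x * v x)))" for k
    by (intro set_integrable_mult_right
        set_integrable_cutoff[OF \<epsilon>_pos cutoff_eq_0[OF \<epsilon>_pos] continuous_on_cutoff[OF \<epsilon>_pos]] continuous_intros)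
  have bound: "\<bar>(mu - lam) * X k\<bar> \<le> cutoff_error k" for k
  proof -
    let ?Y = "\<lambda>x. T k x + (mu - lam) * (cutoff (\<epsilon> k) (\<rho> x) * (u x * v x))"
    have iY: "set_integrable lborel \<Omega> ?Y" by (intro set_integral_add(1) T iX)
    have "(LINT x:\<Omega>|lborel. ?Y x) = (mu - lam) * X k"
      using T iX by (subst set_integral_add(2)) (auto simp: X_def)
    moreover have "(LINT x:\<Omega>|lborel. ?Y x) \<le> cutoff_error k"
      unfolding cutoff_error_def using pointwise
      by (intro set_integral_mono iY set_integrable_cutoff_error) (auto simp: abs_le_iff)
    moreover have "(LINT x:\<Omega>|lborel. - ?Y x) \<le> cutoff_error k"
    proof -
      have "set_integrable lborel \<Omega> (\<lambda>x. - ?Y x)"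
        using iY unfolding set_integrable_def scaleR_minus_right by (rule integrable_minus)
      then show ?thesis
        unfolding cutoff_error_def using pointwise
        by (intro set_integral_mono set_integrable_cutoff_error) (auto simp: abs_le_iff)
    qed
    moreover have "(LINT x:\<Omega>|lborel. - ?Y x) = - (LINT x:\<Omega>|lborel. ?Y x)"
      by (rule set_integral_uminus[OF iY])
    ultimately show ?thesis by linarith
  qed
  have "X \<longlonglongrightarrow> (LINT x:\<Omega>|lborel. u x * v x)"
    using integral_cutoff_power_tendsto[of "\<lambda>x. u x * v x" 1] continuous_closure_u continuous_closure_v
    by (auto simp: X_def[abs_def] \<rho>_def intro!: continuous_intros)
  then have "(\<lambda>k. (mu - lam) * X k) \<longlonglongrightarrow> (mu - lam) * (LINT x:\<Omega>|lborel. u x * v x)"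
    by (intro tendsto_intros)
  moreover have "(\<lambda>k. (mu - lam) * X k) \<longlonglongrightarrow> 0"
    using cutoff_error_tendsto_0 by (rule Lim_null_comparison[rotated]) (use bound in auto)
  ultimately have "(mu - lam) * (LINT x:\<Omega>|lborel. u x * v x) = 0"
    by (rule LIMSEQ_unique)
  then show ?thesis using eigenvalue_less by simp
qed

text \<open>An element of the plane spanned by the two eigenfunctions.\<close>

definition comb :: "real \<Rightarrow> real \<Rightarrow> real^'n \<Rightarrow> real" where
  "comb \<alpha> \<beta> x = \<alpha> * u x + \<beta> * v x"

text \<open>The partial derivatives of \<^const>\<open>comb\<close>.\<close>

definition dcomb :: "real \<Rightarrow> real \<Rightarrow> 'n \<Rightarrow> real^'n \<Rightarrow> real" where
  "dcomb \<alpha> \<beta> i x = \<alpha> * du i x + \<beta> * dv i x"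

text \<open>The partial derivatives of the truncation \<open>c(\<rho>) w\<close> of \<open>w = \<alpha> u + \<beta> v\<close>.\<close>

definition truncation_deriv :: "real \<Rightarrow> real \<Rightarrow> nat \<Rightarrow> 'n \<Rightarrow> real^'n \<Rightarrow> real" where
  "truncation_deriv \<alpha> \<beta> k i x =
     cutoff_deriv (\<epsilon> k) (\<rho> x) * d\<rho> i x * comb \<alpha> \<beta> x + cutoff (\<epsilon> k) (\<rho> x) * dcomb \<alpha> \<beta> i x"

lemma continuous_comb [continuous_intros]: "continuous_on \<Omega> (comb \<alpha> \<beta>)"
  unfolding comb_def[abs_def] by (intro continuous_intros)

lemma continuous_closure_comb: "continuous_on (closure \<Omega>) (comb \<alpha> \<beta>)"
  unfolding comb_def[abs_def] by (intro continuous_intros continuous_closure_u continuous_closure_v)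

lemma continuous_dcomb [continuous_intros]: "continuous_on \<Omega> (dcomb \<alpha> \<beta> i)"
  unfolding dcomb_def[abs_def] by (intro continuous_intros)

lemma continuous_cutoff_\<rho> [continuous_intros]:
  "continuous_on \<Omega> (\<lambda>x. cutoff (\<epsilon> k) (\<rho> x))" "continuous_on \<Omega> (\<lambda>x. cutoff_deriv (\<epsilon> k) (\<rho> x))"
  using continuous_on_compose2[OF continuous_on_cutoff[OF \<epsilon>_pos] continuous_\<rho>]
    continuous_on_compose2[OF continuous_on_cutoff_deriv[OF \<epsilon>_pos] continuous_\<rho>] by auto

lemma continuous_truncation_deriv [continuous_intros]: "continuous_on \<Omega> (truncation_deriv \<alpha> \<beta> k i)"
  unfolding truncation_deriv_def[abs_def] by (intro continuous_intros)

lemma partial_comb: "has_partial_on \<Omega> i (comb \<alpha> \<beta>) (dcomb \<alpha> \<beta> i)"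
  using has_partial_on_add[OF has_partial_on_mult[OF has_partial_on_const[of _ _ \<alpha>] partial_u[of i]]
      has_partial_on_mult[OF has_partial_on_const[of _ _ \<beta>] partial_v[of i]]]
  by (simp add: comb_def[abs_def] dcomb_def[abs_def])

lemma partial_dcomb: "has_partial_on \<Omega> i (dcomb \<alpha> \<beta> i) (\<lambda>x. \<alpha> * ddu i x + \<beta> * ddv i x)"
  using has_partial_on_add[OF has_partial_on_mult[OF has_partial_on_const[of _ _ \<alpha>] partial_du[of i]]
      has_partial_on_mult[OF has_partial_on_const[of _ _ \<beta>] partial_dv[of i]]]
  by (simp add: dcomb_def[abs_def])

lemma partial_truncation:
  "has_partial_on \<Omega> i (\<lambda>x. cutoff (\<epsilon> k) (\<rho> x) * comb \<alpha> \<beta> x) (truncation_deriv \<alpha> \<beta> k i)"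
  using has_partial_on_mult[OF has_partial_on_compose[OF partial_\<rho> DERIV_cutoff[OF \<epsilon>_pos[of k]]] partial_comb]
  by (simp add: truncation_deriv_def[abs_def])

lemma truncation_eq_0:
  assumes "x \<in> \<Omega> - core (\<epsilon> k)"
  shows "cutoff (\<epsilon> k) (\<rho> x) = 0" and "cutoff_deriv (\<epsilon> k) (\<rho> x) = 0"
proof -
  have "x \<in> closure \<Omega>" using assms closure_subset by auto
  with assms have "\<rho> x \<le> \<epsilon> k" by (auto simp: core_def)
  then show "cutoff (\<epsilon> k) (\<rho> x) = 0" "cutoff_deriv (\<epsilon> k) (\<rho> x) = 0"
    by (simp_all add: cutoff_eq_0 cutoff_deriv_eq_0 \<epsilon>_pos)
qed

text \<open>With \<open>w = \<alpha> u + \<beta> v\<close>, expanding the square gives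
  \<open>\<bar>\<nabla>(c w)\<bar>\<^sup>2 = div (c\<^sup>2 w \<nabla>w) - c\<^sup>2 w \<Delta>w + \<bar>\<nabla>c\<bar>\<^sup>2 w\<^sup>2\<close>. The first sum on the right-hand side below is
  the divergence; the potential is estimated from below by \<open>m\<close>, and the last term by a
  multiple of the integrand of \<^const>\<open>cutoff_error\<close>.\<close>

lemma truncation_energy_pointwise:
  fixes k :: nat and x :: "real^'n" and \<alpha> \<beta> :: real
  assumes x: "x \<in> \<Omega>"
  defines "c \<equiv> cutoff (\<epsilon> k) (\<rho> x)" and "c' \<equiv> cutoff_deriv (\<epsilon> k) (\<rho> x)"
  shows "(\<Sum>i\<in>UNIV. (truncation_deriv \<alpha> \<beta> k i x)\<^sup>2)
    \<le> (\<Sum>i\<in>UNIV. (2 * c * c') * d\<rho> i x * (comb \<alpha> \<beta> x * dcomb \<alpha> \<beta> i x)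
          + c\<^sup>2 * (dcomb \<alpha> \<beta> i x * dcomb \<alpha> \<beta> i x + comb \<alpha> \<beta> x * (\<alpha> * ddu i x + \<beta> * ddv i x)))
      + (c\<^sup>2 * (comb \<alpha> \<beta> x * (\<alpha> * lam * u x + \<beta> * mu * v x) - m * (comb \<alpha> \<beta> x)\<^sup>2)
      + 4 * (\<alpha>\<^sup>2 + \<beta>\<^sup>2) * (\<rho> x * c' * energy x))"
proof -
  let ?w = "comb \<alpha> \<beta> x"
  have nn: "0 \<le> c'" "\<rho> x * c' \<le> 1"
    unfolding c'_def by (rule cutoff_deriv_bounds[OF \<epsilon>_pos \<rho>_nonneg])+
  have err: "(\<Sum>i\<in>UNIV. (c' * d\<rho> i x * ?w)\<^sup>2) \<le> 4 * (\<alpha>\<^sup>2 + \<beta>\<^sup>2) * (\<rho> x * c' * energy x)"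
  proof -
    have w: "?w\<^sup>2 \<le> (\<alpha>\<^sup>2 + \<beta>\<^sup>2) * \<rho> x"
    proof -
      have "(\<alpha>\<^sup>2 + \<beta>\<^sup>2) * \<rho> x - ?w\<^sup>2 = (\<alpha> * v x - \<beta> * u x)\<^sup>2"
        by (simp add: comb_def \<rho>_def power2_eq_square algebra_simps)
      then show ?thesis by (smt (verit) zero_le_power2)
    qed
    have r: "(d\<rho> i x)\<^sup>2 \<le> 4 * (\<rho> x * ((du i x)\<^sup>2 + (dv i x)\<^sup>2))" for i
    proof -
      have "4 * (\<rho> x * ((du i x)\<^sup>2 + (dv i x)\<^sup>2)) - (d\<rho> i x)\<^sup>2 = 4 * (u x * dv i x - v x * du i x)\<^sup>2"
        by (simp add: d\<rho>_def \<rho>_def power2_eq_square algebra_simps)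
      then show ?thesis by (smt (verit) zero_le_power2)
    qed
    have "(c' * d\<rho> i x * ?w)\<^sup>2 \<le> c'\<^sup>2 * (4 * (\<rho> x * ((du i x)\<^sup>2 + (dv i x)\<^sup>2))) * ((\<alpha>\<^sup>2 + \<beta>\<^sup>2) * \<rho> x)" for i
      unfolding power_mult_distrib
      by (intro mult_mono mult_left_mono w r) (auto simp: \<rho>_nonneg)
    then have "(\<Sum>i\<in>UNIV. (c' * d\<rho> i x * ?w)\<^sup>2)
        \<le> (\<Sum>i\<in>UNIV. c'\<^sup>2 * (4 * (\<rho> x * ((du i x)\<^sup>2 + (dv i x)\<^sup>2))) * ((\<alpha>\<^sup>2 + \<beta>\<^sup>2) * \<rho> x))"
      by (rule sum_mono)
    also have "\<dots> = 4 * (\<alpha>\<^sup>2 + \<beta>\<^sup>2) * ((\<rho> x * c') * (\<rho> x * c' * energy x))"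
      unfolding energy_def sum_distrib_left
      by (rule sum.cong[OF refl]) (simp add: power2_eq_square algebra_simps)
    also have "\<dots> \<le> 4 * (\<alpha>\<^sup>2 + \<beta>\<^sup>2) * (1 * (\<rho> x * c' * energy x))"
      using nn \<rho>_nonneg[of x] energy_nonneg[of x]
      by (intro mult_left_mono mult_right_mono) auto
    finally show ?thesis by simp
  qed
  have lap0: "(\<Sum>i\<in>UNIV. \<alpha> * ddu i x + \<beta> * ddv i x)
      = q x * ?w - (\<alpha> * lam * u x + \<beta> * mu * v x)"
    unfolding sum.distrib sum_distrib_left[symmetric] laplacian_u[OF x] laplacian_v[OF x]
    by (simp add: comb_def algebra_simps)
  have lap: "(\<Sum>i\<in>UNIV. c\<^sup>2 * (?w * (\<alpha> * ddu i x + \<beta> * ddv i x)))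
      = c\<^sup>2 * (q x * ?w\<^sup>2 - ?w * (\<alpha> * lam * u x + \<beta> * mu * v x))"
    unfolding sum_distrib_left[symmetric] lap0 by (simp add: power2_eq_square algebra_simps)
  have "c\<^sup>2 * (m * ?w\<^sup>2) \<le> c\<^sup>2 * (q x * ?w\<^sup>2)"
    using potential_ge[OF x] by (intro mult_left_mono mult_right_mono) auto
  moreover have "(\<Sum>i\<in>UNIV. (truncation_deriv \<alpha> \<beta> k i x)\<^sup>2)
    = (\<Sum>i\<in>UNIV. (2 * c * c') * d\<rho> i x * (?w * dcomb \<alpha> \<beta> i x)
          + c\<^sup>2 * (dcomb \<alpha> \<beta> i x * dcomb \<alpha> \<beta> i x + ?w * (\<alpha> * ddu i x + \<beta> * ddv i x)))
      - (\<Sum>i\<in>UNIV. c\<^sup>2 * (?w * (\<alpha> * ddu i x + \<beta> * ddv i x)))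
      + (\<Sum>i\<in>UNIV. (c' * d\<rho> i x * ?w)\<^sup>2)"
    unfolding sum_subtractf[symmetric] sum.distrib[symmetric]
    by (rule sum.cong[OF refl])
       (simp add: truncation_deriv_def c_def c'_def power2_eq_square algebra_simps)
  ultimately show ?thesis
    using err unfolding lap by (simp add: algebra_simps)
qed

lemma truncation_energy_le:
  "(\<Sum>i\<in>UNIV. LINT x:\<Omega>|lborel. (truncation_deriv \<alpha> \<beta> k i x)\<^sup>2)
    \<le> (LINT x:\<Omega>|lborel. (cutoff (\<epsilon> k) (\<rho> x))\<^sup>2 *
          (comb \<alpha> \<beta> x * (\<alpha> * lam * u x + \<beta> * mu * v x) - m * (comb \<alpha> \<beta> x)\<^sup>2))
      + 4 * (\<alpha>\<^sup>2 + \<beta>\<^sup>2) * cutoff_error k"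
proof -
  define c where "c r = (cutoff (\<epsilon> k) r)\<^sup>2" for r
  define c' where "c' r = 2 * cutoff (\<epsilon> k) r * cutoff_deriv (\<epsilon> k) r" for r
  define h where "h i x = comb \<alpha> \<beta> x * dcomb \<alpha> \<beta> i x" for i x
  define h' where "h' i x = dcomb \<alpha> \<beta> i x * dcomb \<alpha> \<beta> i x + comb \<alpha> \<beta> x * (\<alpha> * ddu i x + \<beta> * ddv i x)" for i x
  define R where "R x = comb \<alpha> \<beta> x * (\<alpha> * lam * u x + \<beta> * mu * v x) - m * (comb \<alpha> \<beta> x)\<^sup>2" for x
  define T where "T x = (\<Sum>i\<in>UNIV. c' (\<rho> x) * d\<rho> i x * h i x + c (\<rho> x) * h' i x)" for x
  have hp: "has_partial_on \<Omega> i (h i) (h' i)" for i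
    unfolding h_def[abs_def] h'_def[abs_def] by (intro has_partial_on_mult partial_comb partial_dcomb)
  have hc: "continuous_on \<Omega> (h i)" "continuous_on \<Omega> (h' i)" for i
    unfolding h_def[abs_def] h'_def[abs_def] by (intro continuous_intros)+
  have dc: "(c has_real_derivative c' r) (at r)" for r
    unfolding c_def[abs_def] c'_def
    by (auto intro!: derivative_eq_intros DERIV_cutoff[OF \<epsilon>_pos])
  have cc: "continuous_on UNIV c'" "continuous_on UNIV c"
    unfolding c'_def[abs_def] c_def[abs_def]
    by (intro continuous_intros continuous_on_cutoff continuous_on_cutoff_deriv \<epsilon>_pos)+
  have c0: "c r = 0" if "r \<le> \<epsilon> k" for r
    using that by (simp add: c_def cutoff_eq_0[OF \<epsilon>_pos])
  have T: "set_integrable lborel \<Omega> T" "(LINT x:\<Omega>|lborel. T x) = 0"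
    unfolding T_def[abs_def]
    by (rule integral_cutoff_partial_sum[OF \<epsilon>_pos c0 dc cc(1) hp hc]; assumption)+
  have iR: "set_integrable lborel \<Omega> (\<lambda>x. c (\<rho> x) * R x)"
    by (rule set_integrable_cutoff[OF \<epsilon>_pos c0 cc(2)]) (auto simp: R_def[abs_def] intro!: continuous_intros)
  have iE: "set_integrable lborel \<Omega> (\<lambda>x. 4 * (\<alpha>\<^sup>2 + \<beta>\<^sup>2) * (\<rho> x * cutoff_deriv (\<epsilon> k) (\<rho> x) * energy x))"
    by (intro set_integrable_mult_right set_integrable_cutoff_error)
  have ig: "set_integrable lborel \<Omega> (\<lambda>x. (truncation_deriv \<alpha> \<beta> k i x)\<^sup>2)" for i
    by (rule set_integrable_continuous_compact_support[OF _ compact_core core_subset[OF \<epsilon>_pos[of k]]])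
       (auto simp: truncation_deriv_def truncation_eq_0 intro!: continuous_intros)
  have "(\<Sum>i\<in>UNIV. LINT x:\<Omega>|lborel. (truncation_deriv \<alpha> \<beta> k i x)\<^sup>2)
      = (LINT x:\<Omega>|lborel. (\<Sum>i\<in>UNIV. (truncation_deriv \<alpha> \<beta> k i x)\<^sup>2))"
    using ig unfolding set_integrable_def set_lebesgue_integral_def scaleR_sum_right
    by (subst Bochner_Integration.integral_sum) auto
  also have "\<dots> \<le> (LINT x:\<Omega>|lborel. T x + (c (\<rho> x) * R x +
      4 * (\<alpha>\<^sup>2 + \<beta>\<^sup>2) * (\<rho> x * cutoff_deriv (\<epsilon> k) (\<rho> x) * energy x)))"
  proof (rule set_integral_mono)
    show "set_integrable lborel \<Omega> (\<lambda>x. \<Sum>i\<in>UNIV. (truncation_deriv \<alpha> \<beta> k i x)\<^sup>2)"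
      using ig unfolding set_integrable_def scaleR_sum_right by (intro Bochner_Integration.integrable_sum)
    show "set_integrable lborel \<Omega> (\<lambda>x. T x + (c (\<rho> x) * R x +
      4 * (\<alpha>\<^sup>2 + \<beta>\<^sup>2) * (\<rho> x * cutoff_deriv (\<epsilon> k) (\<rho> x) * energy x)))"
      by (intro set_integral_add(1) T iR iE)
    show "(\<Sum>i\<in>UNIV. (truncation_deriv \<alpha> \<beta> k i x)\<^sup>2) \<le> T x + (c (\<rho> x) * R x +
      4 * (\<alpha>\<^sup>2 + \<beta>\<^sup>2) * (\<rho> x * cutoff_deriv (\<epsilon> k) (\<rho> x) * energy x))" if "x \<in> \<Omega>" for x
      using truncation_energy_pointwise[OF that, of \<alpha> \<beta> k]
      by (simp only: T_def c_def c'_def R_def h_def h'_def)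
  qed
  also have "\<dots> = (LINT x:\<Omega>|lborel. c (\<rho> x) * R x) + 4 * (\<alpha>\<^sup>2 + \<beta>\<^sup>2) * cutoff_error k"
    unfolding cutoff_error_def set_integral_mult_right[symmetric]
    by (subst set_integral_add(2), (intro set_integral_add(1) T iR iE)+)
       (subst set_integral_add(2), (intro iR iE)+, simp add: T)
  finally show ?thesis by (simp add: c_def R_def)
qed

lemma integral_comb_square:
  "(LINT x:\<Omega>|lborel. (comb \<alpha> \<beta> x)\<^sup>2)
     = \<alpha>\<^sup>2 * (LINT x:\<Omega>|lborel. (u x)\<^sup>2) + \<beta>\<^sup>2 * (LINT x:\<Omega>|lborel. (v x)\<^sup>2)" (is "?A = _")
  and integral_comb_operator:
  "(LINT x:\<Omega>|lborel. comb \<alpha> \<beta> x * (\<alpha> * lam * u x + \<beta> * mu * v x) - m * (comb \<alpha> \<beta> x)\<^sup>2)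
     = \<alpha>\<^sup>2 * (lam - m) * (LINT x:\<Omega>|lborel. (u x)\<^sup>2) + \<beta>\<^sup>2 * (mu - m) * (LINT x:\<Omega>|lborel. (v x)\<^sup>2)" (is "?B = _")
proof -
  have i: "set_integrable lborel \<Omega> (\<lambda>x. r * (u x)\<^sup>2)" "set_integrable lborel \<Omega> (\<lambda>x. r * (v x)\<^sup>2)"
    "set_integrable lborel \<Omega> (\<lambda>x. r * (u x * v x))" for r
    by (intro set_integrable_closure continuous_intros continuous_closure_u continuous_closure_v)+
  have gen: "(LINT x:\<Omega>|lborel. r * (u x)\<^sup>2 + (s * (v x)\<^sup>2 + t * (u x * v x)))
      = r * (LINT x:\<Omega>|lborel. (u x)\<^sup>2) + s * (LINT x:\<Omega>|lborel. (v x)\<^sup>2)" for r s t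
    by (subst set_integral_add(2), (intro set_integral_add(1) i)+)
       (subst set_integral_add(2), (intro i)+, simp add: eigenfunctions_orthogonal)
  have "?A = (LINT x:\<Omega>|lborel. \<alpha>\<^sup>2 * (u x)\<^sup>2 + (\<beta>\<^sup>2 * (v x)\<^sup>2 + (2 * \<alpha> * \<beta>) * (u x * v x)))"
    by (rule arg_cong[where f="set_lebesgue_integral _ _"])
       (simp add: fun_eq_iff comb_def power2_eq_square algebra_simps)
  then show "?A = \<alpha>\<^sup>2 * (LINT x:\<Omega>|lborel. (u x)\<^sup>2) + \<beta>\<^sup>2 * (LINT x:\<Omega>|lborel. (v x)\<^sup>2)"
    by (simp only: gen)
  have "?B = (LINT x:\<Omega>|lborel. (\<alpha>\<^sup>2 * (lam - m)) * (u x)\<^sup>2 + ((\<beta>\<^sup>2 * (mu - m)) * (v x)\<^sup>2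
      + (\<alpha> * \<beta> * (lam + mu - 2 * m)) * (u x * v x)))"
    by (rule arg_cong[where f="set_lebesgue_integral _ _"])
       (simp add: fun_eq_iff comb_def power2_eq_square algebra_simps)
  then show "?B = \<alpha>\<^sup>2 * (lam - m) * (LINT x:\<Omega>|lborel. (u x)\<^sup>2) + \<beta>\<^sup>2 * (mu - m) * (LINT x:\<Omega>|lborel. (v x)\<^sup>2)"
    by (simp only: gen)
qed

text \<open>The bounds by the eigenvalues of the cube, applied to the truncations of \<open>\<alpha> u + \<beta> v\<close>, in the
  limit of vanishing truncation level.\<close>

lemma comb_energy_bounds:
  assumes "L > 0" and box: "\<Omega> \<subseteq> cbox a (\<chi> j. a $ j + L)"
  defines "U \<equiv> LINT x:\<Omega>|lborel. (u x)\<^sup>2" and "V \<equiv> LINT x:\<Omega>|lborel. (v x)\<^sup>2"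
  shows "real CARD('n) * (pi / L)\<^sup>2 * (\<alpha>\<^sup>2 * U + \<beta>\<^sup>2 * V)
      \<le> \<alpha>\<^sup>2 * (lam - m) * U + \<beta>\<^sup>2 * (mu - m) * V"
    and "(LINT x:\<Omega>|lborel. comb \<alpha> \<beta> x * sine_mode L a (\<lambda>_. 1) x) = 0 \<Longrightarrow>
      (real CARD('n) + 3) * (pi / L)\<^sup>2 * (\<alpha>\<^sup>2 * U + \<beta>\<^sup>2 * V)
      \<le> \<alpha>\<^sup>2 * (lam - m) * U + \<beta>\<^sup>2 * (mu - m) * V"
proof -
  let ?\<psi> = "sine_mode L a (\<lambda>_. 1)"
  define R where "R x = comb \<alpha> \<beta> x * (\<alpha> * lam * u x + \<beta> * mu * v x) - m * (comb \<alpha> \<beta> x)\<^sup>2" for x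
  define A where "A k = (LINT x:\<Omega>|lborel. (cutoff (\<epsilon> k) (\<rho> x) * comb \<alpha> \<beta> x)\<^sup>2)" for k
  define P where "P k = (LINT x:\<Omega>|lborel. cutoff (\<epsilon> k) (\<rho> x) * comb \<alpha> \<beta> x * ?\<psi> x)" for k
  define B where "B k = (LINT x:\<Omega>|lborel. (cutoff (\<epsilon> k) (\<rho> x))\<^sup>2 * R x) + 4 * (\<alpha>\<^sup>2 + \<beta>\<^sup>2) * cutoff_error k" for k
  have comb0: "comb \<alpha> \<beta> x = 0" if "\<rho> x = 0" for x
    using that by (simp add: \<rho>_def comb_def sum_power2_eq_zero_iff)
  have cR: "continuous_on (closure \<Omega>) R"
    unfolding R_def[abs_def]
    by (intro continuous_intros continuous_closure_comb continuous_closure_u continuous_closure_v)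
  have "A \<longlonglongrightarrow> (LINT x:\<Omega>|lborel. (comb \<alpha> \<beta> x)\<^sup>2)"
    using integral_cutoff_power_tendsto[of "\<lambda>x. (comb \<alpha> \<beta> x)\<^sup>2" 2] comb0 continuous_closure_comb
    by (auto simp: A_def[abs_def] power_mult_distrib intro!: continuous_intros)
  then have Alim: "A \<longlonglongrightarrow> \<alpha>\<^sup>2 * U + \<beta>\<^sup>2 * V"
    by (simp only: integral_comb_square U_def V_def)
  have Plim: "P \<longlonglongrightarrow> (LINT x:\<Omega>|lborel. comb \<alpha> \<beta> x * ?\<psi> x)"
    using integral_cutoff_power_tendsto[of "\<lambda>x. comb \<alpha> \<beta> x * ?\<psi> x" 1] comb0 continuous_closure_comb
    by (auto simp: P_def[abs_def] mult.assoc intro!: continuous_intros)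
  have "B \<longlonglongrightarrow> (LINT x:\<Omega>|lborel. R x) + 4 * (\<alpha>\<^sup>2 + \<beta>\<^sup>2) * 0"
    unfolding B_def[abs_def]
    by (intro tendsto_intros cutoff_error_tendsto_0 integral_cutoff_power_tendsto cR)
       (simp add: R_def comb0)
  then have Blim: "B \<longlonglongrightarrow> \<alpha>\<^sup>2 * (lam - m) * U + \<beta>\<^sup>2 * (mu - m) * V"
    by (simp add: R_def integral_comb_operator U_def V_def)
  have le: "(\<Sum>i\<in>UNIV. LINT x:\<Omega>|lborel. (truncation_deriv \<alpha> \<beta> k i x)\<^sup>2) \<le> B k" for k
    unfolding B_def R_def by (rule truncation_energy_le)
  note lower = dirichlet_energy_lower_bounds[OF assms(1) open_domain box compact_core core_subset[OF \<epsilon>_pos]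
      _ _ continuous_truncation_deriv partial_truncation]
  have cf: "continuous_on \<Omega> (\<lambda>x. cutoff (\<epsilon> k) (\<rho> x) * comb \<alpha> \<beta> x)" for k
    by (intro continuous_intros)
  have zf: "cutoff (\<epsilon> k) (\<rho> x) * comb \<alpha> \<beta> x = 0" if "x \<in> \<Omega> - core (\<epsilon> k)" for k x
    using that by (simp add: truncation_eq_0)
  have "real CARD('n) * (pi / L)\<^sup>2 * A k \<le> B k" for k
    unfolding A_def by (rule order_trans[OF lower(1)[OF cf] le]) (rule zf)
  moreover have "(\<lambda>k. real CARD('n) * (pi / L)\<^sup>2 * A k) \<longlonglongrightarrow> real CARD('n) * (pi / L)\<^sup>2 * (\<alpha>\<^sup>2 * U + \<beta>\<^sup>2 * V)"
    by (intro tendsto_intros Alim)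
  ultimately show "real CARD('n) * (pi / L)\<^sup>2 * (\<alpha>\<^sup>2 * U + \<beta>\<^sup>2 * V)
      \<le> \<alpha>\<^sup>2 * (lam - m) * U + \<beta>\<^sup>2 * (mu - m) * V"
    by (intro LIMSEQ_le[OF _ Blim]) auto
  assume orth: "(LINT x:\<Omega>|lborel. comb \<alpha> \<beta> x * ?\<psi> x) = 0"
  define \<gamma> where "\<gamma> = 3 * (pi / L)\<^sup>2 * (2 / L) ^ CARD('n)"
  have "(real CARD('n) + 3) * (pi / L)\<^sup>2 * A k - \<gamma> * (P k)\<^sup>2 \<le> B k" for k
    unfolding A_def P_def \<gamma>_def by (rule order_trans[OF lower(2)[OF cf] le]) (rule zf)
  moreover have "(\<lambda>k. (real CARD('n) + 3) * (pi / L)\<^sup>2 * A k - \<gamma> * (P k)\<^sup>2)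
      \<longlonglongrightarrow> (real CARD('n) + 3) * (pi / L)\<^sup>2 * (\<alpha>\<^sup>2 * U + \<beta>\<^sup>2 * V) - \<gamma> * 0\<^sup>2"
    using Plim unfolding orth by (intro tendsto_intros Alim)
  ultimately show "(real CARD('n) + 3) * (pi / L)\<^sup>2 * (\<alpha>\<^sup>2 * U + \<beta>\<^sup>2 * V)
      \<le> \<alpha>\<^sup>2 * (lam - m) * U + \<beta>\<^sup>2 * (mu - m) * V"
    using LIMSEQ_le[OF _ Blim, of "\<lambda>k. (real CARD('n) + 3) * (pi / L)\<^sup>2 * A k - \<gamma> * (P k)\<^sup>2"] by auto
qed

end

section \<open>Bounds for the first two Dirichlet eigenvalues\<close>

text \<open>Near a fixed point \<open>x0\<close> the function is bounded above; reflecting \<open>x\<close> in \<open>x0\<close> with a small factor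
  lands there, and convexity along this segment bounds the value at \<open>x\<close> from below.\<close>

lemma convex_on_imp_bdd_below:
  fixes q :: "real^'n::finite \<Rightarrow> real"
  assumes "open S" and "bounded S" and q: "convex_on S q"
  shows "bdd_below (q ` S)"
proof (cases "S = {}")
  case False
  then obtain x0 where x0: "x0 \<in> S" by auto
  obtain r where r: "r > 0" "cball x0 r \<subseteq> S"
    using assms(1) x0 open_contains_cball by blast
  obtain R where R: "R > 0" "\<And>x. x \<in> S \<Longrightarrow> norm (x0 - x) \<le> R"
  proof -
    obtain R0 where R0: "\<And>x. x \<in> S \<Longrightarrow> norm x \<le> R0" using assms(2) by (auto simp: bounded_iff)
    show thesis
    proof (rule that[of "\<bar>norm x0 + R0\<bar> + 1"])
      show "norm (x0 - x) \<le> \<bar>norm x0 + R0\<bar> + 1" if "x \<in> S" for x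
        using norm_triangle_ineq4[of x0 x] R0[OF that] by linarith
    qed simp
  qed
  have "continuous_on (cball x0 r) q"
    using convex_on_continuous[OF assms(1) q] r(2) by (rule continuous_on_subset)
  then have "bounded (q ` cball x0 r)"
    by (intro compact_imp_bounded compact_continuous_image) auto
  then obtain C where C: "\<And>y. y \<in> cball x0 r \<Longrightarrow> q y \<le> C"
    by (force simp: bounded_iff abs_le_iff)
  define t where "t = r / R"
  have t: "t > 0" using r R by (simp add: t_def)
  have "((1 + t) * q x0 - C) / t \<le> q x" if x: "x \<in> S" for x
  proof -
    define y where "y = x0 + t *\<^sub>R (x0 - x)"
    have "norm (t *\<^sub>R (x0 - x)) \<le> t * R"
      using R(2)[OF x] t by simp
    then have y: "y \<in> cball x0 r"
      using R(1) by (simp add: y_def dist_norm t_def)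
    define s where "s = 1 + t"
    have s: "s > 0" "1 - t / s = 1 / s" using t by (auto simp: s_def field_simps)
    have sx0: "s *\<^sub>R x0 = y + t *\<^sub>R x" by (simp add: y_def s_def algebra_simps)
    have "x0 = (1 / s) *\<^sub>R (s *\<^sub>R x0)" using s(1) by simp
    also have "\<dots> = (1 - t / s) *\<^sub>R y + (t / s) *\<^sub>R x"
      unfolding sx0 s(2) by (simp add: scaleR_add_right)
    finally have "q x0 \<le> (1 - t / s) * q y + (t / s) * q x"
      using convex_onD[OF q, of "t / s" y x] t s y r(2) x by (auto simp: s_def)
    then have "s * q x0 \<le> s * ((1 / s) * q y + (t / s) * q x)"
      unfolding s(2) using s(1) by (intro mult_left_mono) auto
    also have "\<dots> = q y + t * q x" using s(1) by (simp add: distrib_left)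
    also have "\<dots> \<le> C + t * q x" using C[OF y] by simp
    finally show ?thesis using t by (simp add: s_def field_simps)
  qed
  then show ?thesis by (auto intro!: bdd_belowI2)
qed simp

lemma integral_square_pos:
  fixes f :: "real^'n::finite \<Rightarrow> real"
  assumes "open S" and "bounded S" and f: "continuous_on (closure S) f" and "x0 \<in> S" and "f x0 \<noteq> 0"
  shows "0 < (LINT x:S|lborel. (f x)\<^sup>2)"
proof -
  define c where "c = (f x0)\<^sup>2 / 2"
  have c: "c > 0" "c < (f x0)\<^sup>2" using assms(5) by (auto simp: c_def)
  have "continuous_on S (\<lambda>x. (f x)\<^sup>2)"
    using f closure_subset[of S] by (intro continuous_intros) (rule continuous_on_subset)
  then have "open (S \<inter> (\<lambda>x. (f x)\<^sup>2) -` {c<..})"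
    using assms(1) by (intro continuous_open_preimage) auto
  then obtain d where d: "d > 0" "ball x0 d \<subseteq> S \<inter> (\<lambda>x. (f x)\<^sup>2) -` {c<..}"
    using assms(4) c(2) by (metis IntI greaterThan_iff openE vimageI)
  have fin: "emeasure lborel (ball x0 d) < \<infinity>" by (rule emeasure_bounded_finite) simp
  have "0 < c * measure lborel (ball x0 d)"
    using c(1) content_ball_pos[OF d(1)] by simp
  also have "\<dots> = (\<integral>x. c * indicator (ball x0 d) x \<partial>lborel)" by simp
  also have "\<dots> \<le> (\<integral>x. indicator S x *\<^sub>R (f x)\<^sup>2 \<partial>lborel)"
  proof (rule integral_mono)
    show "integrable lborel (\<lambda>x. c * indicator (ball x0 d) x)"
      using fin by (intro integrable_mult_right integrable_real_indicator) auto
    have "set_integrable lborel S (\<lambda>x. (f x)\<^sup>2)"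
      by (intro set_integrable_continuous_closure assms(1,2) continuous_intros f)
    then show "integrable lborel (\<lambda>x. indicator S x *\<^sub>R (f x)\<^sup>2)" by (simp add: set_integrable_def)
    show "c * indicator (ball x0 d) x \<le> indicator S x *\<^sub>R (f x)\<^sup>2" for x
      using d(2) by (fastforce simp: indicator_def)
  qed
  finally show ?thesis by (simp add: set_lebesgue_integral_def)
qed

lemma subset_cube_of_diameter:
  fixes S :: "(real^'n::finite) set"
  assumes "bounded S"
  obtains a where "S \<subseteq> cbox a (\<chi> j. a $ j + diameter S)"
proof
  define a :: "real^'n" where "a = (\<chi> j. Inf ((\<lambda>x. x $ j) ` S))"
  show "S \<subseteq> cbox a (\<chi> j. a $ j + diameter S)"
  proof
    fix x assume x: "x \<in> S"
    have "a $ j \<le> x $ j \<and> x $ j \<le> a $ j + diameter S" for j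
    proof
      have "bounded ((\<lambda>x. x $ j) ` S)"
        using bounded_linear_image[OF assms bounded_linear_vec_nth] .
      then show "a $ j \<le> x $ j"
        using x by (auto simp: a_def intro!: cInf_lower bounded_imp_bdd_below)
      have "x $ j - diameter S \<le> a $ j"
        unfolding a_def vec_lambda_beta
      proof (rule cInf_greatest)
        fix z assume "z \<in> (\<lambda>x. x $ j) ` S"
        then obtain y where y: "y \<in> S" "z = y $ j" by auto
        have "\<bar>(x - y) $ j\<bar> \<le> dist x y" unfolding dist_norm by (rule component_le_norm_cart)
        also have "\<dots> \<le> diameter S" by (rule diameter_bounded_bound[OF assms x y(1)])
        finally show "x $ j - diameter S \<le> z" by (simp add: y(2))
      qed (use x in auto)
      then show "x $ j \<le> a $ j + diameter S" by simp
    qed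
    then show "x \<in> cbox a (\<chi> j. a $ j + diameter S)" by (simp add: mem_box_cart)
  qed
qed

lemma diameter_open_pos:
  fixes S :: "(real^'n::finite) set"
  assumes "open S" and "S \<noteq> {}" and "bounded S"
  shows "diameter S > 0"
proof -
  obtain x where x: "x \<in> S" using assms(2) by auto
  obtain e where e: "e > 0" "cball x e \<subseteq> S"
    using assms(1) x open_contains_cball by blast
  define y where "y = x + e *\<^sub>R axis undefined 1"
  have "dist x y = e" using e(1) by (simp add: y_def dist_norm)
  then have "y \<in> S" using e by auto
  from diameter_bounded_bound[OF assms(3) x this] show ?thesis
    using \<open>dist x y = e\<close> e(1) by simp
qed

theorem corollary6p3:
  fixes \<Omega> :: "(real^'n::finite) set" and q :: "real^'n \<Rightarrow> real" and D lam0 lam1 :: real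
  assumes "open \<Omega>" and "\<Omega> \<noteq> {}" and "bounded \<Omega>" and "convex \<Omega>"
    and "D = diameter \<Omega>"
    and "convex_on \<Omega> q"
    and "first_two_dirichlet_eigenvalues \<Omega> q lam0 lam1"
  shows "lam0 \<ge> real CARD('n) * (pi / D)\<^sup>2 + (INF x\<in>\<Omega>. q x)
    \<and> lam1 \<ge> (real CARD('n) + 3) * (pi / D)\<^sup>2 + (INF x\<in>\<Omega>. q x)"
proof -
  define m where "m = (INF x\<in>\<Omega>. q x)"
  let ?n = "real CARD('n)"
  have D: "D > 0" using diameter_open_pos[OF assms(1-3)] assms(5) by simp
  obtain a where box: "\<Omega> \<subseteq> cbox a (\<chi> j. a $ j + D)"
    using subset_cube_of_diameter[OF assms(3)] assms(5) by blast
  obtain u v where u: "dirichlet_eigenfunction \<Omega> q lam0 u" and v: "dirichlet_eigenfunction \<Omega> q lam1 v"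
    and less: "lam0 < lam1"
    using assms(7) by (auto simp: first_two_dirichlet_eigenvalues_def dirichlet_eigenvalue_def)
  have m: "m \<le> q x" if "x \<in> \<Omega>" for x
    unfolding m_def by (rule cINF_lower[OF convex_on_imp_bdd_below[OF assms(1,3,6)] that])
  interpret dirichlet_pair \<Omega> q lam0 lam1 m u v
    by unfold_locales (use assms(1,3) u v m less in auto)
  define U where "U = (LINT x:\<Omega>|lborel. (u x)\<^sup>2)"
  define V where "V = (LINT x:\<Omega>|lborel. (v x)\<^sup>2)"
  have U: "U > 0" and V: "V > 0"
    using u v integral_square_pos[OF assms(1,3) continuous_closure_u] integral_square_pos[OF assms(1,3) continuous_closure_v]
    by (auto simp: U_def V_def dirichlet_eigenfunction_def)
  note bounds = comb_energy_bounds[OF D box, folded U_def V_def]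
  have "?n * (pi / D)\<^sup>2 * U \<le> (lam0 - m) * U"
    using bounds(1)[of 1 0] by simp
  then have first: "?n * (pi / D)\<^sup>2 \<le> lam0 - m" using U by simp
  let ?\<psi> = "sine_mode D a (\<lambda>_. 1)"
  define b where "b = (LINT x:\<Omega>|lborel. u x * ?\<psi> x)"
  define c where "c = (LINT x:\<Omega>|lborel. v x * ?\<psi> x)"
  \<comment> \<open>one linear condition on the plane spanned by \<open>u\<close> and \<open>v\<close>: orthogonality to the first eigenfunction of the cube\<close>
  obtain \<alpha> \<beta> where ab: "\<alpha> \<noteq> 0 \<or> \<beta> \<noteq> 0" "\<alpha> * b + \<beta> * c = 0"
  proof (cases "b = 0 \<and> c = 0")
    case True
    then show thesis using that[of 1 1] by simp
  next
    case False
    then show thesis using that[of c "- b"] by auto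
  qed
  have "set_integrable lborel \<Omega> (\<lambda>x. u x * ?\<psi> x)" "set_integrable lborel \<Omega> (\<lambda>x. v x * ?\<psi> x)"
    by (intro set_integrable_closure continuous_intros continuous_closure_u continuous_closure_v)+
  then have "(LINT x:\<Omega>|lborel. \<alpha> * (u x * ?\<psi> x) + \<beta> * (v x * ?\<psi> x)) = \<alpha> * b + \<beta> * c"
    by (simp add: b_def c_def)
  then have orth: "(LINT x:\<Omega>|lborel. comb \<alpha> \<beta> x * ?\<psi> x) = 0"
    by (simp add: comb_def ab(2) distrib_right mult.assoc)
  have pos: "\<alpha>\<^sup>2 * U + \<beta>\<^sup>2 * V > 0"
    using ab(1) U V by (cases "\<alpha> = 0") (auto intro!: add_pos_nonneg)
  have "(?n + 3) * (pi / D)\<^sup>2 * (\<alpha>\<^sup>2 * U + \<beta>\<^sup>2 * V) \<le> \<alpha>\<^sup>2 * (lam0 - m) * U + \<beta>\<^sup>2 * (lam1 - m) * V"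
    by (rule bounds(2)[OF orth])
  also have "\<dots> \<le> (lam1 - m) * (\<alpha>\<^sup>2 * U + \<beta>\<^sup>2 * V)"
  proof -
    have "(lam0 - m) * (\<alpha>\<^sup>2 * U) \<le> (lam1 - m) * (\<alpha>\<^sup>2 * U)"
      using less U by (intro mult_right_mono) auto
    then show ?thesis by (simp add: algebra_simps)
  qed
  finally have "(?n + 3) * (pi / D)\<^sup>2 \<le> lam1 - m" using pos by simp
  with first show ?thesis unfolding m_def by linarith
qed

end
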